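(* Let $\epsilon\in[0,1]$ and $\tau=\min\{\epsilon,1/2\}$. Let $H$ be a graph having a vertex whose removal results in a bipartite graph $B$ with $\mathrm{ex}(n,B)=O(n^{2-\epsilon})$. Then there is a constant $C>0$ such that $\mathrm{sp}(m,H)\ge C\, m^{(1+2\tau)/(2+\tau)}$ for all $m\ge1$. Moreover, if in addition $\mathrm{ex}(n,H)=O(n^{2-\alpha})$ for some $\alpha\in[0,1]$, then there is a constant $C'>0$ such that $\mathrm{sp}(m,H)\ge C'\, m^{\tau+(1-\tau)/(2-\alpha)}$ for all $m\ge1$.
   Context: All graphs are finite and simple. For a graph $G$ with $m$ edges, $\mathrm{sp}(G)=\mathrm{mc}(G)-m/2$, where $\mathrm{mc}(G)$ is the maximum number of edges crossing a bipartition of $V(G)$. A graph is $H$-free if it contains no copy of $H$ as a subgraph. $\mathrm{sp}(m,H)$ is the minimum of $\mathrm{sp}(G)$ over all $H$-free graphs $G$ with $m$ edges. $\mathrm{ex}(n,F)$ is the maximum number of edges of an $n$-vertex $F$-free graph. *)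

theory Defs
  imports Complex_Main "HOL-Library.Extended_Real" "HOL-Library.Landau_Symbols"
begin

record 'a graph =
  verts :: "'a set"
  edges :: "'a set set"

definition finite_simple_graph :: "'a graph \<Rightarrow> bool" where
  "finite_simple_graph G \<longleftrightarrow> finite (verts G) \<and> (\<forall>e\<in>edges G. e \<subseteq> verts G \<and> card e = 2)"

definition delete_vertex :: "'a graph \<Rightarrow> 'a \<Rightarrow> 'a graph" where
  "delete_vertex G v = \<lparr>verts = verts G - {v}, edges = {e \<in> edges G. v \<notin> e}\<rparr>"

definition cut_edges :: "'a graph \<Rightarrow> 'a set \<Rightarrow> 'a set set" where
  "cut_edges G A = {e \<in> edges G. e \<inter> A \<noteq> {} \<and> e \<inter> (verts G - A) \<noteq> {}}"

definition bipartite :: "'a graph \<Rightarrow> bool" where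
  "bipartite G \<longleftrightarrow> (\<exists>A\<subseteq>verts G. \<forall>e\<in>edges G. e \<inter> A \<noteq> {} \<and> e \<inter> (verts G - A) \<noteq> {})"

definition max_cut :: "'a graph \<Rightarrow> nat" where
  "max_cut G = Max {card (cut_edges G A) | A. A \<subseteq> verts G}"

definition surplus :: "'a graph \<Rightarrow> real" where
  "surplus G = real (max_cut G) - real (card (edges G)) / 2"

text \<open>Copies are subgraphs that need not be induced.\<close>

definition contains_copy :: "'a graph \<Rightarrow> 'b graph \<Rightarrow> bool" where
  "contains_copy F G \<longleftrightarrow>
     (\<exists>f. inj_on f (verts F) \<and> f ` verts F \<subseteq> verts G \<and> (\<forall>e\<in>edges F. f ` e \<in> edges G))"

definition free_of :: "'a graph \<Rightarrow> 'b graph \<Rightarrow> bool" where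
  "free_of F G \<longleftrightarrow> \<not> contains_copy F G"

text \<open>
  The two extremal functions below range over graphs with vertices in \<^typ>\<open>nat\<close>; every finite
  graph is isomorphic to such a graph.

  The supremum in \<open>ex_num\<close> is taken over a finite set of natural numbers, so it is a maximum
  whenever some \<open>n\<close>-vertex \<open>F\<close>-free graph exists. If none exists (which happens only if \<open>F\<close> has no
  edges), its value is \<open>0\<close>.
\<close>

definition ex_num :: "nat \<Rightarrow> 'a graph \<Rightarrow> nat" where
  "ex_num n F = Sup {card (edges G) | G :: nat graph.
     finite_simple_graph G \<and> card (verts G) = n \<and> free_of F G}"

text \<open>
  The surplus of a graph with \<open>m\<close> edges lies in the finite set of numbers \<open>k - m / 2\<close> with \<open>k \<le> m\<close>,
  so the infimum is a minimum whenever some \<open>H\<close>-free graph with \<open>m\<close> edges exists. If none exists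
  (which happens only if \<open>H\<close> has at most one edge), its value is \<open>\<infinity>\<close>.
\<close>

definition min_surplus :: "nat \<Rightarrow> 'a graph \<Rightarrow> ereal" where
  "min_surplus m H = Inf {ereal (surplus G) | G :: nat graph.
     finite_simple_graph G \<and> card (edges G) = m \<and> free_of H G}"

lemma ex_num_eq_Max:
  fixes F :: "'a graph" and n :: nat
  defines "S \<equiv> {card (edges G) | G :: nat graph.
     finite_simple_graph G \<and> card (verts G) = n \<and> free_of F G}"
  assumes "S \<noteq> {}"
  shows "finite S" and "ex_num n F = Max S"
proof -
  have "card (edges G) \<le> 2 ^ n" if "finite_simple_graph G" "card (verts G) = n" for G :: "nat graph"
  proof -
    have "edges G \<subseteq> Pow (verts G)" "finite (verts G)"
      using that by (auto simp: finite_simple_graph_def)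
    then show ?thesis using that(2) card_mono[of "Pow (verts G)" "edges G"] by (simp add: card_Pow)
  qed
  then have "S \<subseteq> {..2 ^ n}" by (auto simp: S_def)
  then show fin: "finite S" using finite_subset by blast
  show "ex_num n F = Max S"
    unfolding ex_num_def S_def[symmetric] using cSup_eq_Max[OF fin assms(2)] .
qed

lemma max_cut_le:
  assumes "finite_simple_graph G"
  shows "max_cut G \<le> card (edges G)"
proof -
  have fin: "finite (verts G)" "edges G \<subseteq> Pow (verts G)"
    using assms by (auto simp: finite_simple_graph_def)
  then have fE: "finite (edges G)" using finite_subset by blast
  have le: "card (cut_edges G A) \<le> card (edges G)" for A
    by (rule card_mono[OF fE]) (auto simp: cut_edges_def)
  have "{card (cut_edges G A) | A. A \<subseteq> verts G} \<subseteq> {..card (edges G)}" using le by auto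
  then have "finite {card (cut_edges G A) | A. A \<subseteq> verts G}" using finite_subset by blast
  moreover have "{card (cut_edges G A) | A. A \<subseteq> verts G} \<noteq> {}" by auto
  ultimately show ?thesis unfolding max_cut_def using le by auto
qed

lemma min_surplus_attained:
  fixes H :: "'a graph" and G\<^sub>0 :: "nat graph"
  assumes "finite_simple_graph G\<^sub>0" "card (edges G\<^sub>0) = m" "free_of H G\<^sub>0"
  obtains G :: "nat graph"
  where "finite_simple_graph G" "card (edges G) = m" "free_of H G"
    and "min_surplus m H = ereal (surplus G)"
proof -
  define S where "S = {ereal (surplus G) | G :: nat graph.
     finite_simple_graph G \<and> card (edges G) = m \<and> free_of H G}"
  have "S \<subseteq> (\<lambda>k. ereal (real k - real m / 2)) ` {..m}"
    using max_cut_le by (fastforce simp: S_def surplus_def)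
  then have "finite S" using finite_surj[of "{..m}"] by blast
  moreover have "S \<noteq> {}" using assms by (auto simp: S_def)
  ultimately have "Inf S \<in> S" using Min_in Min_Inf by metis
  then show thesis using that unfolding min_surplus_def S_def by blast
qed

end

theory Submission
  imports Defs
begin

text \<open>
  Choose random signs \<open>s\<^sub>w\<close>, give every vertex the two random numbers \<open>sin (a\<^sub>v \<bullet> s)\<close> and
  \<open>sin (b\<^sub>v \<bullet> s)\<close>, and let \<open>x\<^sub>v \<in> [-1, 1]\<close> be half their difference. Rounding \<open>x\<close> to a cut gives
  surplus at least a constant times the sum of \<open>(a\<^sub>u \<bullet> b\<^sub>v) / 4 - a\<^sub>u \<bullet> a\<^sub>v - b\<^sub>u \<bullet> b\<^sub>v\<close> over the adjacent
  pairs, since the sines are bounded and their correlations are explicit products of cosines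
  that are comparable to the inner products.

  Let \<open>D\<close> be the degeneracy of \<open>G\<close>. In an \<open>H\<close>-free graph each neighbourhood is \<open>B\<close>-free, hence sparse.
  Taking \<open>a\<^sub>v\<close> a multiple of the unit vector of \<open>v\<close> and \<open>b\<^sub>v\<close> a multiple of the indicator of the
  neighbours preceding \<open>v\<close> in a degenerate order gives surplus of order \<open>m D\<^bsup>\<tau> - 1\<^esup>\<close>. On an induced
  subgraph with \<open>N\<close> vertices and minimum degree \<open>D\<close>, this is at least of order \<open>D\<^bsup>1 + 2 \<tau>\<^esup>\<close> when \<open>N\<close>
  is at least of order \<open>D\<^bsup>1 + \<epsilon>\<^esup>\<close>; otherwise taking \<open>a\<^sub>v\<close> the scaled indicator of the
  neighbourhood of \<open>v\<close> and \<open>b\<^sub>v\<close> a constant vector gives surplus of order \<open>D\<^sup>2\<close>. Balancing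
  \<open>m D\<^bsup>\<tau> - 1\<^esup>\<close> and \<open>D\<^bsup>1 + 2 \<tau>\<^esup>\<close> proves the first bound, and the bound on \<open>D\<close> that follows from
  \<open>ex(n, H) = O(n\<^bsup>2 - \<alpha>\<^esup>)\<close> proves the second.
\<close>

section \<open>Random signs and sines\<close>

text \<open>A sign vector is encoded by the set of its \<open>+1\<close> coordinates, so the mean
  over independent random signs is the average over \<open>Pow W\<close>.\<close>

definition sgn_in :: "'a set \<Rightarrow> 'a \<Rightarrow> real" where
  "sgn_in A w = (if w \<in> A then 1 else - 1)"

text \<open>The expectation of sin(a . s) sin(b . s) for uniform signs s on \<open>W\<close>, in
  closed form; see \<open>sum_Pow_sin_sin\<close>.\<close>

definition sin_corr :: "'a set \<Rightarrow> ('a \<Rightarrow> real) \<Rightarrow> ('a \<Rightarrow> real) \<Rightarrow> real" where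
  "sin_corr W a b = ((\<Prod>w\<in>W. cos (a w - b w)) - (\<Prod>w\<in>W. cos (a w + b w))) / 2"

text \<open>Induction on \<open>W\<close>: the sign of a new coordinate shifts the phase by
  \<open>a v\<close> or \<open>- a v\<close>, and cos(y - a) + cos(y + a) = 2 cos y cos a. The free
  phase \<open>y\<close> makes the induction go through.\<close>

lemma sum_Pow_cos:
  assumes "finite W"
  shows "(\<Sum>A\<in>Pow W. cos (y + (\<Sum>w\<in>W. a w * sgn_in A w))) = 2 ^ card W * cos y * (\<Prod>w\<in>W. cos (a w))"
  using assms
proof (induction W arbitrary: y)
  case empty
  then show ?case by simp
next
  case (insert v W)
  define S where "S A = (\<Sum>w\<in>W. a w * sgn_in A w)" for A
  have S_insert: "S (insert v A) = S A" for A
    unfolding S_def using insert(2) by (intro sum.cong) (auto simp: sgn_in_def)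
  have inj: "inj_on (insert v) (Pow W)"
    using insert(2) by (auto simp: inj_on_def)
  have "(\<Sum>A\<in>Pow (insert v W). cos (y + (\<Sum>w\<in>insert v W. a w * sgn_in A w))) =
        (\<Sum>A\<in>Pow W. cos (y + (a v * sgn_in A v + S A))) +
        (\<Sum>A\<in>insert v ` Pow W. cos (y + (a v * sgn_in A v + S A)))"
    using insert(1,2) by (subst Pow_insert, subst sum.union_disjoint) (auto simp: S_def)
  also have "(\<Sum>A\<in>Pow W. cos (y + (a v * sgn_in A v + S A))) = (\<Sum>A\<in>Pow W. cos ((y - a v) + S A))"
    using insert(2) by (intro sum.cong) (auto simp: sgn_in_def algebra_simps)
  also have "(\<Sum>A\<in>insert v ` Pow W. cos (y + (a v * sgn_in A v + S A))) =
        (\<Sum>A\<in>Pow W. cos ((y + a v) + S A))"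
    by (subst sum.reindex[OF inj]) (simp add: S_insert sgn_in_def algebra_simps)
  finally have "(\<Sum>A\<in>Pow (insert v W). cos (y + (\<Sum>w\<in>insert v W. a w * sgn_in A w))) =
      2 ^ card W * (cos (y - a v) + cos (y + a v)) * (\<Prod>w\<in>W. cos (a w))"
    using insert(3)[of "y - a v"] insert(3)[of "y + a v"] by (simp add: S_def algebra_simps)
  then show ?case
    using insert(1,2) by (simp add: cos_add cos_diff)
qed

lemma sum_Pow_sin_sin:
  assumes "finite W"
  shows "(\<Sum>A\<in>Pow W. sin (\<Sum>w\<in>W. a w * sgn_in A w) * sin (\<Sum>w\<in>W. b w * sgn_in A w)) =
         2 ^ card W * sin_corr W a b"
proof -
  have "sin (\<Sum>w\<in>W. a w * sgn_in A w) * sin (\<Sum>w\<in>W. b w * sgn_in A w) =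
     (cos (0 + (\<Sum>w\<in>W. (a w - b w) * sgn_in A w)) - cos (0 + (\<Sum>w\<in>W. (a w + b w) * sgn_in A w))) / 2" for A
    by (simp add: sin_times_sin left_diff_distrib distrib_right sum_subtractf sum.distrib)
  then have "(\<Sum>A\<in>Pow W. sin (\<Sum>w\<in>W. a w * sgn_in A w) * sin (\<Sum>w\<in>W. b w * sgn_in A w)) =
    ((\<Sum>A\<in>Pow W. cos (0 + (\<Sum>w\<in>W. (a w - b w) * sgn_in A w)))
      - (\<Sum>A\<in>Pow W. cos (0 + (\<Sum>w\<in>W. (a w + b w) * sgn_in A w)))) / 2"
    by (simp only: sum_divide_distrib[symmetric] sum_subtractf)
  then show ?thesis
    unfolding sum_Pow_cos[OF assms] by (simp add: sin_corr_def algebra_simps)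
qed

lemma sin_corr_commute: "sin_corr W a b = sin_corr W b a"
proof -
  have "cos (a w - b w) = cos (b w - a w)" for w
    by (metis cos_minus minus_diff_eq)
  then show ?thesis
    by (simp add: sin_corr_def add.commute)
qed

text \<open>Two products of numbers in [-1, 1] differ by at most the sum of the differences of their
  factors, and here each of these is 2 |sin (a w) sin (b w)|.\<close>

lemma sin_corr_le: "sin_corr W a b \<le> (\<Sum>w\<in>W. \<bar>a w * b w\<bar>)"
proof -
  have "\<bar>(\<Prod>w\<in>W. cos (a w - b w)) - (\<Prod>w\<in>W. cos (a w + b w))\<bar>
      \<le> (\<Sum>w\<in>W. \<bar>cos (a w - b w) - cos (a w + b w)\<bar>)"
    using norm_prod_diff[of W "\<lambda>w. cos (a w - b w)" "\<lambda>w. cos (a w + b w)"] by simp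
  also have "\<dots> = (\<Sum>w\<in>W. 2 * \<bar>sin (a w) * sin (b w)\<bar>)"
    by (intro sum.cong) (auto simp: cos_add cos_diff abs_mult)
  also have "\<dots> \<le> (\<Sum>w\<in>W. 2 * \<bar>a w * b w\<bar>)"
    unfolding abs_mult by (intro sum_mono mult_left_mono mult_mono abs_sin_x_le_abs_x) auto
  finally show ?thesis
    by (simp add: sin_corr_def flip: sum_distrib_left)
qed

lemma one_minus_cos_le: "1 - cos x \<le> x\<^sup>2 / 2" for x :: real
proof -
  have "\<bar>sin (x / 2)\<bar>\<^sup>2 \<le> \<bar>x / 2\<bar>\<^sup>2"
    by (intro power_mono abs_sin_x_le_abs_x) auto
  then show ?thesis
    using cos_double_sin[of "x / 2"] by (simp add: power2_eq_square)
qed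

lemma half_le_sin:
  assumes "0 \<le> x" "x \<le> (1::real)"
  shows "x / 2 \<le> sin x"
proof -
  have "sin 0 - 0 / 2 \<le> sin x - x / 2"
  proof (rule DERIV_nonneg_imp_nondecreasing[OF assms(1)])
    fix y :: real
    assume y: "0 \<le> y" "y \<le> x"
    then have "y\<^sup>2 \<le> 1"
      using assms by (simp add: power_le_one)
    then have "0 \<le> cos y - 1 / 2"
      using one_minus_cos_le[of y] by simp
    then show "\<exists>d. ((\<lambda>x. sin x - x / 2) has_real_derivative d) (at y) \<and> 0 \<le> d"
      by (auto intro!: exI[of _ "cos y - 1/2"] derivative_eq_intros)
  qed
  then show ?thesis by simp
qed

text \<open>Turning \<open>y\<close> into \<open>x\<close> one factor at a time adds
  \<open>x v - y v\<close> times a product of the other factors, which is at least the full product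
  of the \<open>y w\<close> because \<open>y w \<le> x w\<close> and
  \<open>y w \<le> 1\<close>.\<close>

lemma prod_diff_ge:
  fixes x y :: "'a \<Rightarrow> real"
  assumes "finite W" "\<And>w. w \<in> W \<Longrightarrow> 0 \<le> y w \<and> y w \<le> x w \<and> y w \<le> 1"
  shows "(\<Prod>w\<in>W. y w) * (\<Sum>w\<in>W. x w - y w) \<le> (\<Prod>w\<in>W. x w) - (\<Prod>w\<in>W. y w)"
  using assms
proof (induction W)
  case empty
  then show ?case by simp
next
  case (insert v W)
  let ?X = "\<Prod>w\<in>W. x w" and ?Y = "\<Prod>w\<in>W. y w" and ?S = "\<Sum>w\<in>W. x w - y w"
  have v: "0 \<le> y v" "y v \<le> x v" "y v \<le> 1"
    using insert.prems by auto
  have "?Y \<le> ?X" "0 \<le> ?Y"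
    using insert.prems by (auto intro: prod_mono prod_nonneg)
  have "y v * ?Y * (x v - y v) \<le> ?Y * (x v - y v)"
    using v \<open>0 \<le> ?Y\<close> by (intro mult_right_mono) (auto simp: mult_left_le_one_le)
  also have "\<dots> \<le> ?X * (x v - y v)"
    using v \<open>?Y \<le> ?X\<close> by (intro mult_right_mono) auto
  finally have 1: "y v * ?Y * (x v - y v) \<le> ?X * (x v - y v)" .
  have 2: "y v * (?Y * ?S) \<le> y v * (?X - ?Y)"
    using insert v by (intro mult_left_mono) auto
  show ?case
    using insert(1,2) 1 2 by (simp add: algebra_simps)
qed

text \<open>The norm condition keeps the product of the cos (a w + b w) above 1/2, so
  \<open>prod_diff_ge\<close> reduces the claim to single factors, where cos (a - b) - cos (a + b) =
  2 sin a sin b \<ge> a b / 2. The product, this estimate and the halving in \<open>sin_corr\<close>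
  each cost a factor 2.\<close>

lemma sin_corr_ge:
  assumes "finite W" "\<And>w. w \<in> W \<Longrightarrow> 0 \<le> a w \<and> 0 \<le> b w" "(\<Sum>w\<in>W. (a w + b w)\<^sup>2) \<le> 1"
  shows "(\<Sum>w\<in>W. a w * b w) / 8 \<le> sin_corr W a b"
proof -
  have le1: "a w + b w \<le> 1" if "w \<in> W" for w
  proof -
    have "(a w + b w)\<^sup>2 \<le> (\<Sum>w\<in>W. (a w + b w)\<^sup>2)"
      using assms(1) that by (intro member_le_sum) auto
    then show ?thesis
      using assms(3) by (meson abs_le_square_iff abs_le_D1 abs_square_le_1 order_trans)
  qed
  have sin_half: "a w / 2 \<le> sin (a w)" "b w / 2 \<le> sin (b w)" if "w \<in> W" for w
    using half_le_sin[of "a w"] half_le_sin[of "b w"] le1[OF that] assms(2)[OF that] by auto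
  have prod_half: "a w * b w / 4 \<le> sin (a w) * sin (b w)" if "w \<in> W" for w
    using mult_mono[OF sin_half[OF that]] assms(2)[OF that] sin_half[OF that] by simp
  have cos_nonneg: "0 \<le> cos (a w + b w)" if "w \<in> W" for w
  proof -
    have "(a w + b w)\<^sup>2 \<le> 1"
      using that le1[OF that] assms(2)[OF that] by (simp add: power_le_one)
    then show ?thesis
      using one_minus_cos_le[of "a w + b w"] by simp
  qed
  have "\<bar>(\<Prod>w\<in>W. 1) - (\<Prod>w\<in>W. cos (a w + b w))\<bar> \<le> (\<Sum>w\<in>W. \<bar>1 - cos (a w + b w)\<bar>)"
    using norm_prod_diff[of W "\<lambda>_. 1" "\<lambda>w. cos (a w + b w)"] by simp
  also have "\<dots> \<le> (\<Sum>w\<in>W. (a w + b w)\<^sup>2 / 2)"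
    using one_minus_cos_le by (intro sum_mono) simp
  also have "\<dots> \<le> 1 / 2"
    using assms(3) by (simp flip: sum_divide_distrib)
  finally have "1 - (\<Prod>w\<in>W. cos (a w + b w)) \<le> 1 / 2"
    unfolding prod.neutral_const by (rule abs_le_D1)
  then have "1 / 2 \<le> (\<Prod>w\<in>W. cos (a w + b w))" by simp
  moreover have "0 \<le> (\<Sum>w\<in>W. a w * b w / 2)"
    using assms(2) by (intro sum_nonneg) auto
  moreover have "(\<Sum>w\<in>W. a w * b w / 2) \<le> (\<Sum>w\<in>W. cos (a w - b w) - cos (a w + b w))"
    unfolding cos_add cos_diff by (intro sum_mono) (drule prod_half, linarith)
  ultimately have "1 / 2 * (\<Sum>w\<in>W. a w * b w / 2)
      \<le> (\<Prod>w\<in>W. cos (a w + b w)) * (\<Sum>w\<in>W. cos (a w - b w) - cos (a w + b w))"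
    by (intro mult_mono) auto
  also have "\<dots> \<le> (\<Prod>w\<in>W. cos (a w - b w)) - (\<Prod>w\<in>W. cos (a w + b w))"
  proof (rule prod_diff_ge[OF assms(1)])
    fix w assume w: "w \<in> W"
    have "0 \<le> sin (a w) * sin (b w)"
      using prod_half[OF w] assms(2)[OF w] mult_nonneg_nonneg[of "a w" "b w"] by linarith
    then show "0 \<le> cos (a w + b w) \<and> cos (a w + b w) \<le> cos (a w - b w) \<and> cos (a w + b w) \<le> 1"
      using cos_nonneg[OF w] cos_le_one[of "a w + b w"] by (simp add: cos_add cos_diff)
  qed
  finally show ?thesis
    by (simp add: sin_corr_def flip: sum_divide_distrib)
qed

section \<open>Surplus and quadratic forms\<close>

definition induce :: "'a graph \<Rightarrow> 'a set \<Rightarrow> 'a graph" where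
  "induce G S = \<lparr>verts = S, edges = {e \<in> edges G. e \<subseteq> S}\<rparr>"

text \<open>Ordered pairs, so that each edge occurs in both orientations and a quadratic form needs
  no choice of orientation.\<close>

definition arcs :: "'a graph \<Rightarrow> ('a \<times> 'a) set" where
  "arcs G = {(u, v). {u, v} \<in> edges G}"

definition nbrs :: "'a graph \<Rightarrow> 'a \<Rightarrow> 'a set" where
  "nbrs G v = {u. {u, v} \<in> edges G}"

section \<open>Ordered adjacent pairs, degrees and double sums\<close>

lemma verts_induce [simp]: "verts (induce G S) = S"
  by (simp add: induce_def)

lemma finite_verts: "finite_simple_graph G \<Longrightarrow> finite (verts G)"
  by (simp add: finite_simple_graph_def)

lemma finite_edges: "finite_simple_graph G \<Longrightarrow> finite (edges G)"
  by (auto simp: finite_simple_graph_def intro: finite_subset[of _ "Pow (verts G)"])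

lemma finite_simple_graph_induce:
  "finite_simple_graph G \<Longrightarrow> S \<subseteq> verts G \<Longrightarrow> finite_simple_graph (induce G S)"
  by (auto simp: finite_simple_graph_def induce_def intro: finite_subset)

lemma induce_induce: "T \<subseteq> S \<Longrightarrow> induce (induce G S) T = induce G T"
  by (auto simp: induce_def)

lemma arcsD:
  assumes "finite_simple_graph G" "(u, v) \<in> arcs G"
  shows "u \<in> verts G" "v \<in> verts G" "u \<noteq> v"
proof -
  have "{u, v} \<subseteq> verts G" "card {u, v} = 2"
    using assms unfolding arcs_def finite_simple_graph_def by auto
  then show "u \<in> verts G" "v \<in> verts G" "u \<noteq> v" by auto
qed

lemma arcs_iff_nbrs: "(u, v) \<in> arcs G \<longleftrightarrow> u \<in> nbrs G v"
  by (simp add: arcs_def nbrs_def)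

lemma arcs_sym: "(u, v) \<in> arcs G \<longleftrightarrow> (v, u) \<in> arcs G"
  by (simp add: arcs_def insert_commute)

lemma nbrs_subset: "finite_simple_graph G \<Longrightarrow> nbrs G v \<subseteq> verts G"
  using arcsD(1) by (auto simp flip: arcs_iff_nbrs)

lemma finite_nbrs: "finite_simple_graph G \<Longrightarrow> finite (nbrs G v)"
  using nbrs_subset finite_verts finite_subset by metis

lemma arcs_subset: "finite_simple_graph G \<Longrightarrow> arcs G \<subseteq> verts G \<times> verts G"
  using arcsD by fastforce

lemma finite_arcs: "finite_simple_graph G \<Longrightarrow> finite (arcs G)"
  using arcs_subset finite_verts by (metis finite_SigmaI finite_subset)

lemma arcs_induce: "arcs (induce G S) = {(u, v) \<in> arcs G. u \<in> S \<and> v \<in> S}"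
  by (auto simp: arcs_def induce_def)

lemma nbrs_induce: "v \<in> S \<Longrightarrow> nbrs (induce G S) v = nbrs G v \<inter> S"
  by (auto simp: nbrs_def induce_def)

lemma sum_arcs:
  assumes "finite_simple_graph G"
  shows "(\<Sum>(u, v)\<in>arcs G. f u v) = (\<Sum>v\<in>verts G. \<Sum>u\<in>nbrs G v. f u v)"
proof -
  have "(\<Sum>v\<in>verts G. \<Sum>u\<in>nbrs G v. f u v) = (\<Sum>(v, u)\<in>(SIGMA v:verts G. nbrs G v). f u v)"
    using assms by (intro sum.Sigma) (auto simp: finite_verts finite_nbrs)
  also have "\<dots> = (\<Sum>(u, v)\<in>arcs G. f u v)"
    using arcsD(2)[OF assms]
    by (intro sum.reindex_bij_witness[of _ prod.swap prod.swap]) (auto simp flip: arcs_iff_nbrs)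
  finally show ?thesis by simp
qed

lemma sum_arcs_swap: "(\<Sum>(u, v)\<in>arcs G. f u v) = (\<Sum>(u, v)\<in>arcs G. f v u)"
  by (intro sum.reindex_bij_witness[of _ prod.swap prod.swap]) (auto simp: arcs_sym)

lemma card_arcs_of:
  fixes E :: "'a set set"
  assumes "finite E" "\<And>e. e \<in> E \<Longrightarrow> card e = 2"
  shows "card {(u, v). {u, v} \<in> E} = 2 * card E"
proof -
  have "card {(u, v). {u, v} = e} = 2" if "e \<in> E" for e :: "'a set"
  proof -
    obtain x y where e: "e = {x, y}" "x \<noteq> y"
      using assms(2)[OF \<open>e \<in> E\<close>] by (auto simp: card_2_iff)
    then have "{(u, v). {u, v} = e} = {(x, y), (y, x)}"
      by (auto simp: doubleton_eq_iff)
    then show ?thesis using e by simp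
  qed
  moreover have "{(u, v). {u, v} \<in> E} = (\<Union>e\<in>E. {(u, v). {u, v} = e})" by auto
  moreover have "finite {(u, v). {u, v} = e}" if "e \<in> E" for e :: "'a set"
    using calculation(1)[OF that] by (intro card_ge_0_finite) simp
  ultimately have "card {(u, v). {u, v} \<in> E} = (\<Sum>e\<in>E. 2)"
    using assms(1) by (simp add: card_UN_disjoint disjoint_iff)
  then show ?thesis by simp
qed

lemma card_arcs: "finite_simple_graph G \<Longrightarrow> card (arcs G) = 2 * card (edges G)"
  unfolding arcs_def by (rule card_arcs_of) (auto simp: finite_edges finite_simple_graph_def)

lemma sum_card_nbrs:
  assumes "finite_simple_graph G"
  shows "(\<Sum>v\<in>verts G. card (nbrs G v)) = 2 * card (edges G)"
  using sum_arcs[OF assms, of "\<lambda>_ _. 1::nat"] card_arcs[OF assms] by simp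

section \<open>Cuts as sign vectors, and rounding of vectors in the cube\<close>

lemma cut_edges_surplus:
  assumes G: "finite_simple_graph G" and A: "A \<subseteq> verts G"
    and x: "\<And>v. v \<in> verts G \<Longrightarrow> x v = sgn_in A v"
  shows "real (card (cut_edges G A)) - real (card (edges G)) / 2 = - (\<Sum>(u, v)\<in>arcs G. x u * x v) / 4"
proof -
  have cutE: "cut_edges G A \<subseteq> edges G" by (auto simp: cut_edges_def)
  \<comment> \<open>An uncut edge contributes 2 to the sum over arcs and a cut edge -2, so the sum
    is 2 m - 4 cut.\<close>
  have *: "x u * x v = 1 - 2 * of_bool ({u, v} \<in> cut_edges G A)" if "(u, v) \<in> arcs G" for u v
    using arcsD[OF G that] that by (auto simp: x sgn_in_def cut_edges_def arcs_def)
  have "(\<Sum>(u, v)\<in>arcs G. x u * x v) = (\<Sum>(u, v)\<in>arcs G. 1 - 2 * of_bool ({u, v} \<in> cut_edges G A))"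
    using * by (intro sum.cong) auto
  also have "\<dots> = real (card (arcs G)) - 2 * real (card {(u, v) \<in> arcs G. {u, v} \<in> cut_edges G A})"
    using finite_arcs[OF G]
    by (simp add: case_prod_unfold sum_subtractf flip: sum_distrib_left) (simp add: Int_def)
  also have "{(u, v) \<in> arcs G. {u, v} \<in> cut_edges G A} = {(u, v). {u, v} \<in> cut_edges G A}"
    using cutE by (auto simp: arcs_def)
  also have "card \<dots> = 2 * card (cut_edges G A)"
    using cutE G finite_subset[OF cutE finite_edges[OF G]]
    by (intro card_arcs_of) (auto simp: finite_simple_graph_def)
  finally show ?thesis
    using card_arcs[OF G] by simp
qed

lemma finite_cut_sizes:
  assumes "finite_simple_graph G"
  shows "finite {card (cut_edges G A) | A. A \<subseteq> verts G}"
  using assms by (simp add: finite_verts setcompr_eq_image Collect_conj_eq flip: Pow_def)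

lemma card_cut_edges_le_max_cut:
  assumes "finite_simple_graph G" "A \<subseteq> verts G"
  shows "card (cut_edges G A) \<le> max_cut G"
  unfolding max_cut_def using assms by (intro Max_ge finite_cut_sizes) auto

lemma max_cut_attained:
  assumes "finite_simple_graph G"
  obtains A where "A \<subseteq> verts G" "card (cut_edges G A) = max_cut G"
proof -
  have "max_cut G \<in> {card (cut_edges G A) | A. A \<subseteq> verts G}"
    unfolding max_cut_def using assms by (intro Max_in finite_cut_sizes) auto
  then show thesis using that by auto
qed

text \<open>The form \<open>\<Sum> x\<^sub>u x\<^sub>v\<close> is affine in each coordinate, so the coordinates can be moved to
  \<open>\<plusminus>1\<close> one at a time without increasing it.\<close>

lemma surplus_ge_form:
  assumes G: "finite_simple_graph G" and x: "\<And>v. v \<in> verts G \<Longrightarrow> \<bar>x v\<bar> \<le> 1"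
  shows "- (\<Sum>(u, v)\<in>arcs G. x u * x v) / 4 \<le> surplus G"
proof -
  let ?Q = "\<lambda>x. \<Sum>(u, v)\<in>arcs G. x u * x v :: real"
  have "\<exists>y. (\<forall>v\<in>W. \<bar>y v\<bar> = 1) \<and> (\<forall>v\<in>verts G. \<bar>y v\<bar> \<le> 1) \<and> ?Q y \<le> ?Q x" if "finite W" for W
    using that
  proof (induction W)
    case empty
    then show ?case using x by auto
  next
    case (insert w W)
    then obtain y where y: "\<forall>v\<in>W. \<bar>y v\<bar> = 1" "\<forall>v\<in>verts G. \<bar>y v\<bar> \<le> 1" "?Q y \<le> ?Q x"
      by blast
    show ?case
    proof (cases "w \<in> verts G")
      case False
      have "?Q (y(w := 1)) = ?Q y"
        using False arcsD[OF G] by (intro sum.cong) auto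
      then show ?thesis
        using y insert(2) by (intro exI[of _ "y(w := 1)"]) auto
    next
      case True
      define z where "z = y(w := 0)"
      \<comment> \<open>\<open>c\<close> is the slope of the form in the coordinate
        \<open>w\<close>. No arc joins \<open>w\<close> to itself, so there is no quadratic term,
        and the endpoint \<open>t\<close> with \<open>t * c = - \<bar>c\<bar>\<close> does at least
        as well as \<open>y w\<close>.\<close>
      define c where "c = (\<Sum>(u, v)\<in>arcs G. of_bool (u = w) * z v + z u * of_bool (v = w))"
      have Q: "?Q (y(w := t)) = ?Q z + t * c" for t
      proof -
        have "(y(w := t)) u * (y(w := t)) v =
            z u * z v + t * (of_bool (u = w) * z v + z u * of_bool (v = w))"
          if "(u, v) \<in> arcs G" for u v
          using arcsD(3)[OF G that] by (auto simp: z_def)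
        then have "?Q (y(w := t)) =
            (\<Sum>(u, v)\<in>arcs G. z u * z v + t * (of_bool (u = w) * z v + z u * of_bool (v = w)))"
          by (intro sum.cong) auto
        then show ?thesis
          unfolding c_def sum_distrib_left by (simp add: case_prod_unfold sum.distrib)
      qed
      define t :: real where "t = (if c \<ge> 0 then - 1 else 1)"
      have "\<bar>y w * c\<bar> \<le> \<bar>c\<bar>"
        using y(2) True by (simp add: abs_mult mult_left_le_one_le)
      moreover have "t * c = - \<bar>c\<bar>"
        by (simp add: t_def)
      ultimately have "t * c \<le> y w * c"
        by linarith
      then have "?Q (y(w := t)) \<le> ?Q y"
        using Q[of t] Q[of "y w"] by simp
      then show ?thesis
        using y by (intro exI[of _ "y(w := t)"]) (auto simp: t_def)
    qed
  qed
  from this[OF finite_verts[OF G]]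
  obtain y where y: "\<forall>v\<in>verts G. \<bar>y v\<bar> = 1" "?Q y \<le> ?Q x" by auto
  define A where "A = {v \<in> verts G. y v = 1}"
  have A: "A \<subseteq> verts G" by (auto simp: A_def)
  have "y v = sgn_in A v" if "v \<in> verts G" for v
    using y(1) that by (auto simp: A_def sgn_in_def)
  from cut_edges_surplus[OF G A, of y, OF this] have "- ?Q y / 4 \<le> surplus G"
    using card_cut_edges_le_max_cut[OF G A] by (simp add: surplus_def)
  then show ?thesis using y(2) by simp
qed

lemma surplus_nonneg: "finite_simple_graph G \<Longrightarrow> 0 \<le> surplus G"
  using surplus_ge_form[of G "\<lambda>_. 0"] by (simp add: case_prod_unfold)

text \<open>An optimal sign vector of the induced graph, extended by 0, has the same form value in
  \<open>G\<close> and is rounded by \<open>surplus_ge_form\<close>.\<close>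

lemma surplus_induce_le:
  assumes G: "finite_simple_graph G" and S: "S \<subseteq> verts G"
  shows "surplus (induce G S) \<le> surplus G"
proof -
  have GS: "finite_simple_graph (induce G S)"
    using assms by (rule finite_simple_graph_induce)
  obtain A where A: "A \<subseteq> S" "card (cut_edges (induce G S) A) = max_cut (induce G S)"
    using max_cut_attained[OF GS] by auto
  define x where "x v = (if v \<in> S then sgn_in A v else 0)" for v
  have "(\<Sum>(u, v)\<in>arcs (induce G S). x u * x v) = (\<Sum>(u, v)\<in>arcs G. x u * x v)"
    by (intro sum.mono_neutral_left finite_arcs G) (auto simp: arcs_induce x_def split: if_splits)
  moreover have "surplus (induce G S) = - (\<Sum>(u, v)\<in>arcs (induce G S). x u * x v) / 4"
    using cut_edges_surplus[OF GS, of A x] A by (simp add: surplus_def x_def)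
  moreover have "- (\<Sum>(u, v)\<in>arcs G. x u * x v) / 4 \<le> surplus G"
    by (rule surplus_ge_form[OF G]) (simp add: x_def sgn_in_def)
  ultimately show ?thesis by simp
qed

text \<open>Averaging \<open>surplus_ge_form\<close> over all signs leaves only correlations. Those
  within one family are bounded above by \<open>sin_corr_le\<close>, the cross ones below by
  \<open>sin_corr_ge\<close>, which is where \<open>small\<close> enters. The 16 combines the 4 of
  the form with the 4 of the squared halving in \<open>x\<close>.\<close>

lemma surplus_ge_inner_products:
  assumes G: "finite_simple_graph G" and W: "finite W"
    and nonneg: "\<And>v w. 0 \<le> a v w \<and> 0 \<le> b v w"
    and small: "\<And>u v. (u, v) \<in> arcs G \<Longrightarrow> (\<Sum>w\<in>W. (a u w + b v w)\<^sup>2) \<le> 1"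
  shows "(\<Sum>(u, v)\<in>arcs G. (\<Sum>w\<in>W. a u w * b v w) / 4 - (\<Sum>w\<in>W. a u w * a v w)
           - (\<Sum>w\<in>W. b u w * b v w)) / 16 \<le> surplus G"
proof -
  define p where "p v A = sin (\<Sum>w\<in>W. a v w * sgn_in A w)" for v A
  define q where "q v A = sin (\<Sum>w\<in>W. b v w * sgn_in A w)" for v A
  \<comment> \<open>Halving keeps the vector in [-1, 1]. The minus sign makes the cross correlations
    enter \<open>x A u * x A v\<close> negatively, so they raise the surplus.\<close>
  define x where "x A v = (p v A - q v A) / 2" for A v
  let ?k = "\<lambda>u v. sin_corr W (a u) (a v) - sin_corr W (a u) (b v)
                - sin_corr W (b u) (a v) + sin_corr W (b u) (b v)"
  have x1: "\<bar>x A v\<bar> \<le> 1" for A v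
  proof -
    have "\<bar>p v A\<bar> \<le> 1" "\<bar>q v A\<bar> \<le> 1"
      by (simp_all add: p_def q_def)
    then show ?thesis
      unfolding x_def abs_le_iff by auto
  qed
  have avg: "(\<Sum>A\<in>Pow W. x A u * x A v) = 2 ^ card W * (?k u v / 4)" for u v
  proof -
    have "(\<Sum>A\<in>Pow W. x A u * x A v) =
       (\<Sum>A\<in>Pow W. (p u A * p v A - p u A * q v A - q u A * p v A + q u A * q v A) / 4)"
      by (intro sum.cong) (auto simp: x_def algebra_simps add_divide_distrib diff_divide_distrib)
    also have "\<dots> = ((\<Sum>A\<in>Pow W. p u A * p v A) - (\<Sum>A\<in>Pow W. p u A * q v A)
         - (\<Sum>A\<in>Pow W. q u A * p v A) + (\<Sum>A\<in>Pow W. q u A * q v A)) / 4"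
      by (simp only: sum_subtractf sum.distrib flip: sum_divide_distrib)
    finally show ?thesis
      unfolding p_def q_def sum_Pow_sin_sin[OF W] by (simp add: algebra_simps)
  qed
  have "(\<Sum>A\<in>Pow W. - (\<Sum>(u, v)\<in>arcs G. x A u * x A v) / 4) \<le> (\<Sum>A\<in>Pow W. surplus G)"
    by (intro sum_mono surplus_ge_form G x1)
  also have "(\<Sum>A\<in>Pow W. - (\<Sum>(u, v)\<in>arcs G. x A u * x A v) / 4) =
      - (\<Sum>(u, v)\<in>arcs G. (\<Sum>A\<in>Pow W. x A u * x A v)) / 4"
    using sum.swap[of "\<lambda>A (u, v). x A u * x A v" "arcs G" "Pow W"]
    by (simp add: case_prod_unfold sum_negf flip: sum_divide_distrib)
  also have "\<dots> = 2 ^ card W * (- (\<Sum>(u, v)\<in>arcs G. ?k u v) / 16)"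
    by (simp add: avg case_prod_unfold flip: sum_distrib_left sum_divide_distrib)
  finally have "2 ^ card W * (- (\<Sum>(u, v)\<in>arcs G. ?k u v) / 16) \<le> 2 ^ card W * surplus G"
    using W by (simp add: card_Pow)
  then have "- (\<Sum>(u, v)\<in>arcs G. ?k u v) / 16 \<le> surplus G"
    by (rule mult_left_le_imp_le) simp
  moreover have "(\<Sum>(u, v)\<in>arcs G. ?k u v) \<le> - (\<Sum>(u, v)\<in>arcs G. (\<Sum>w\<in>W. a u w * b v w) / 4
      - (\<Sum>w\<in>W. a u w * a v w) - (\<Sum>w\<in>W. b u w * b v w))"
  proof -
    have upper: "sin_corr W (f u) (f v) \<le> (\<Sum>w\<in>W. f u w * f v w)"
      if "\<And>v w. 0 \<le> f v w" for f :: "'a \<Rightarrow> 'b \<Rightarrow> real" and u v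
      using sin_corr_le[of W "f u" "f v"] that by simp
    \<comment> \<open>Both cross terms have the same sum over arcs; two of them at 1/8 each give the
      factor 1/4.\<close>
    have "(\<Sum>(u, v)\<in>arcs G. sin_corr W (b u) (a v)) = (\<Sum>(u, v)\<in>arcs G. sin_corr W (a u) (b v))"
      by (subst sum_arcs_swap) (simp add: sin_corr_commute)
    then have "(\<Sum>(u, v)\<in>arcs G. ?k u v) = (\<Sum>(u, v)\<in>arcs G. sin_corr W (a u) (a v)
         - 2 * sin_corr W (a u) (b v) + sin_corr W (b u) (b v))"
      by (simp add: case_prod_unfold sum.distrib sum_subtractf flip: sum_distrib_left)
    also have "\<dots> \<le> (\<Sum>(u, v)\<in>arcs G. (\<Sum>w\<in>W. a u w * a v w)
         - (\<Sum>w\<in>W. a u w * b v w) / 4 + (\<Sum>w\<in>W. b u w * b v w))"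
    proof (intro sum_mono, clarify)
      fix u v assume "(u, v) \<in> arcs G"
      from sin_corr_ge[OF W _ small[OF this]] nonneg
      show "sin_corr W (a u) (a v) - 2 * sin_corr W (a u) (b v) + sin_corr W (b u) (b v)
          \<le> (\<Sum>w\<in>W. a u w * a v w) - (\<Sum>w\<in>W. a u w * b v w) / 4 + (\<Sum>w\<in>W. b u w * b v w)"
        using upper[of a u v] upper[of b u v] by simp
    qed
    finally show ?thesis
      by (simp add: case_prod_unfold sum.distrib sum_subtractf)
  qed
  ultimately show ?thesis by simp
qed

section \<open>Two choices of weights\<close>

definition local_edges :: "'a graph \<Rightarrow> 'a set \<Rightarrow> nat" where
  "local_edges G S = card (edges (induce G S))"

definition back_nbrs :: "'a graph \<Rightarrow> ('a \<Rightarrow> nat) \<Rightarrow> 'a \<Rightarrow> 'a set" where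
  "back_nbrs G r v = {u \<in> nbrs G v. r u < r v}"

section \<open>Counting back-neighbours and triangles\<close>

lemma card_arcs_induce:
  assumes "finite_simple_graph G" "S \<subseteq> verts G"
  shows "card {(u, v) \<in> arcs G. u \<in> S \<and> v \<in> S} = 2 * local_edges G S"
  using card_arcs[OF finite_simple_graph_induce[OF assms]] by (simp add: arcs_induce local_edges_def)

lemma finite_back: "finite_simple_graph G \<Longrightarrow> finite (back_nbrs G r v)"
  by (simp add: back_nbrs_def finite_nbrs)

lemma back_subset: "finite_simple_graph G \<Longrightarrow> back_nbrs G r v \<subseteq> verts G"
  using nbrs_subset by (fastforce simp: back_nbrs_def)

lemma rank_neq:
  "finite_simple_graph G \<Longrightarrow> inj_on r (verts G) \<Longrightarrow> (u, v) \<in> arcs G \<Longrightarrow> r u \<noteq> r v"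
  using arcsD by (metis inj_onD)

lemma sum_arcs_back:
  assumes G: "finite_simple_graph G"
  shows "(\<Sum>(u, v)\<in>arcs G. of_bool (u \<in> back_nbrs G r v)) = (\<Sum>v\<in>verts G. real (card (back_nbrs G r v)))"
proof -
  have "(\<Sum>u\<in>nbrs G v. of_bool (u \<in> back_nbrs G r v)) = real (card (back_nbrs G r v))" for v
    using finite_nbrs[OF G, of v] by (simp add: back_nbrs_def Int_def)
  then show ?thesis
    unfolding sum_arcs[OF G] by simp
qed

text \<open>As \<open>r\<close> is injective, each edge is counted exactly once, at its later
  end.\<close>

lemma sum_card_back:
  assumes G: "finite_simple_graph G" and r: "inj_on r (verts G)"
  shows "(\<Sum>v\<in>verts G. real (card (back_nbrs G r v))) = real (card (edges G))"
proof -
  have "of_bool (u \<in> back_nbrs G r v) + of_bool (v \<in> back_nbrs G r u) = (1 :: real)"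
    if "(u, v) \<in> arcs G" for u v
    using rank_neq[OF G r that] that arcs_sym[of u v G] by (auto simp: back_nbrs_def arcs_iff_nbrs)
  then have "(\<Sum>(u, v)\<in>arcs G. 1) =
      (\<Sum>(u, v)\<in>arcs G. of_bool (u \<in> back_nbrs G r v) + of_bool (v \<in> back_nbrs G r u) :: real)"
    by (intro sum.cong) auto
  also have "\<dots> = 2 * (\<Sum>(u, v)\<in>arcs G. of_bool (u \<in> back_nbrs G r v))"
    using sum_arcs_swap[of "\<lambda>u v. of_bool (v \<in> back_nbrs G r u) :: real" G]
    by (simp add: case_prod_unfold sum.distrib)
  finally show ?thesis
    using card_arcs[OF G] sum_arcs_back[OF G, of r] by simp
qed

lemma card_edges_le_back:
  assumes "finite_simple_graph G" "inj_on r (verts G)" "\<And>v. v \<in> verts G \<Longrightarrow> card (back_nbrs G r v) \<le> D"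
  shows "card (edges G) \<le> card (verts G) * D"
proof -
  have "real (card (edges G)) \<le> (\<Sum>v\<in>verts G. real D)"
    unfolding sum_card_back[OF assms(1,2), symmetric] using assms(3) by (intro sum_mono) simp
  then show ?thesis
    by (simp flip: of_nat_mult)
qed

text \<open>Both sides count triangles with a distinguished corner \<open>w\<close> and an
  orientation of the opposite edge.\<close>

lemma sum_common_nbrs:
  assumes G: "finite_simple_graph G"
  shows "(\<Sum>(u, v)\<in>arcs G. real (card (nbrs G u \<inter> nbrs G v))) =
         2 * (\<Sum>w\<in>verts G. real (local_edges G (nbrs G w)))"
proof -
  have "real (card (nbrs G u \<inter> nbrs G v)) = (\<Sum>w\<in>verts G. of_bool (u \<in> nbrs G w \<and> v \<in> nbrs G w))" for u v
  proof -
    have "nbrs G u \<inter> nbrs G v = {w \<in> verts G. u \<in> nbrs G w \<and> v \<in> nbrs G w}"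
      using nbrs_subset[OF G, of u] by (auto simp: nbrs_def insert_commute)
    then show ?thesis
      using finite_verts[OF G] by (simp add: Int_def)
  qed
  then have "(\<Sum>(u, v)\<in>arcs G. real (card (nbrs G u \<inter> nbrs G v))) =
      (\<Sum>w\<in>verts G. \<Sum>(u, v)\<in>arcs G. of_bool (u \<in> nbrs G w \<and> v \<in> nbrs G w))"
    by (simp add: case_prod_unfold sum.swap[of _ "verts G"])
  also have "\<dots> = (\<Sum>w\<in>verts G. real (2 * local_edges G (nbrs G w)))"
  proof (intro sum.cong refl)
    fix w
    have "(\<Sum>(u, v)\<in>arcs G. of_bool (u \<in> nbrs G w \<and> v \<in> nbrs G w)) =
        real (card {(u, v) \<in> arcs G. u \<in> nbrs G w \<and> v \<in> nbrs G w})"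
      using finite_arcs[OF G] by (simp add: case_prod_unfold Int_def)
    also have "\<dots> = real (2 * local_edges G (nbrs G w))"
      by (subst card_arcs_induce[OF G nbrs_subset[OF G]]) simp
    finally show "(\<Sum>(u, v)\<in>arcs G. of_bool (u \<in> nbrs G w \<and> v \<in> nbrs G w)) = real (2 * local_edges G (nbrs G w))" .
  qed
  finally show ?thesis by (simp add: sum_distrib_left)
qed

text \<open>An edge together with a common earlier neighbour is a triangle, which is charged to its last vertex.\<close>

lemma sum_common_back_le:
  assumes G: "finite_simple_graph G" and r: "inj_on r (verts G)"
  shows "(\<Sum>(u, v)\<in>arcs G. real (card (back_nbrs G r u \<inter> back_nbrs G r v))) \<le>
         2 * (\<Sum>w\<in>verts G. real (local_edges G (back_nbrs G r w)))"
proof -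
  let ?X = "SIGMA p:arcs G. back_nbrs G r (fst p) \<inter> back_nbrs G r (snd p)"
  let ?Y = "SIGMA w:verts G. {(u, v) \<in> arcs G. u \<in> back_nbrs G r w \<and> v \<in> back_nbrs G r w}"
  \<comment> \<open>The later end of the arc becomes the apex. The common earlier neighbour
    \<open>w\<close> has the least rank of the three, so its place in the remaining arc records
    which end was later; this makes \<open>f\<close> injective.\<close>
  define f where "f = (\<lambda>((u, v), w). if r u < r v then (v, (u, w)) else (u, (w, v)))"
  have finY: "finite ?Y"
    using finite_verts[OF G] finite_arcs[OF G] by (intro finite_SigmaI) (auto intro: finite_subset[of _ "arcs G"])
  have "inj_on f ?X"
  proof (rule inj_onI)
    fix p q assume "p \<in> ?X" "q \<in> ?X" "f p = f q"
    moreover obtain u v w where "p = ((u, v), w)" by (metis surj_pair)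
    moreover obtain u' v' w' where "q = ((u', v'), w')" by (metis surj_pair)
    ultimately show "p = q"
      by (auto simp: f_def back_nbrs_def split: if_splits)
  qed
  moreover have "f ((u, v), w) \<in> ?Y"
    if "(u, v) \<in> arcs G" "w \<in> back_nbrs G r u" "w \<in> back_nbrs G r v" for u v w
    using that arcsD[OF G that(1)] rank_neq[OF G r that(1)]
    by (auto simp: f_def back_nbrs_def nbrs_def arcs_def insert_commute)
  then have "f ` ?X \<subseteq> ?Y" by (intro image_subsetI) (metis (no_types, lifting) IntD1 IntD2 SigmaE fst_conv snd_conv surj_pair)
  ultimately have "card ?X \<le> card ?Y"
    using finY by (rule card_inj_on_le)
  moreover have "card ?X = (\<Sum>(u, v)\<in>arcs G. card (back_nbrs G r u \<inter> back_nbrs G r v))"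
    using finite_arcs[OF G] by (simp add: finite_back[OF G] case_prod_unfold)
  moreover have "card ?Y = (\<Sum>w\<in>verts G. 2 * local_edges G (back_nbrs G r w))"
    using finite_verts[OF G]
    by (subst card_SigmaI)
      (auto simp: card_arcs_induce[OF G back_subset[OF G]] intro: finite_subset[OF _ finite_arcs[OF G]])
  ultimately have "(\<Sum>(u, v)\<in>arcs G. card (back_nbrs G r u \<inter> back_nbrs G r v))
      \<le> (\<Sum>w\<in>verts G. 2 * local_edges G (back_nbrs G r w))"
    by linarith
  then have "real (\<Sum>(u, v)\<in>arcs G. card (back_nbrs G r u \<inter> back_nbrs G r v))
      \<le> real (\<Sum>w\<in>verts G. 2 * local_edges G (back_nbrs G r w))"
    by (rule of_nat_mono)
  then show ?thesis
    by (simp add: case_prod_unfold sum_distrib_left)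
qed

section \<open>Surplus from indicator weights\<close>

lemma sum_of_bool_mult:
  assumes "finite W" "A \<subseteq> W"
  shows "(\<Sum>w\<in>W. (c * of_bool (w \<in> A)) * (d * of_bool (w \<in> B))) = c * d * real (card (A \<inter> B))"
proof -
  have "(\<Sum>w\<in>W. (c * of_bool (w \<in> A)) * (d * of_bool (w \<in> B))) = (\<Sum>w\<in>W. c * d * of_bool (w \<in> A \<inter> B))"
    by (intro sum.cong) auto
  also have "\<dots> = c * d * real (card (W \<inter> (A \<inter> B)))"
    using assms(1) by (simp add: Int_def flip: sum_distrib_left)
  also have "W \<inter> (A \<inter> B) = A \<inter> B" using assms(2) by auto
  finally show ?thesis .
qed

lemma sum_weights_squared_le:
  assumes "finite W" "A \<subseteq> W" "B \<subseteq> W"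
  shows "(\<Sum>w\<in>W. (c * of_bool (w \<in> A) + d * of_bool (w \<in> B))\<^sup>2) \<le>
         2 * c\<^sup>2 * real (card A) + 2 * d\<^sup>2 * real (card B)"
proof -
  have "(\<Sum>w\<in>W. (c * of_bool (w \<in> A) + d * of_bool (w \<in> B))\<^sup>2) \<le>
      (\<Sum>w\<in>W. 2 * ((c * of_bool (w \<in> A)) * (c * of_bool (w \<in> A)))
           + 2 * ((d * of_bool (w \<in> B)) * (d * of_bool (w \<in> B))))"
  proof (intro sum_mono)
    fix w
    have "(x + y)\<^sup>2 \<le> 2 * (x * x) + 2 * (y * y)" for x y :: real
      using zero_le_power2[of "x - y"] by (simp add: power2_eq_square algebra_simps)
    then show "(c * of_bool (w \<in> A) + d * of_bool (w \<in> B))\<^sup>2 \<le> 2 * ((c * of_bool (w \<in> A)) * (c * of_bool (w \<in> A)))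
           + 2 * ((d * of_bool (w \<in> B)) * (d * of_bool (w \<in> B)))" .
  qed
  then show ?thesis
    unfolding sum.distrib sum_distrib_left[symmetric] sum_of_bool_mult[OF assms(1,2)]
      sum_of_bool_mult[OF assms(1,3)] by (simp add: power2_eq_square)
qed

text \<open>Multiples of distinct unit vectors are orthogonal and detect the back-edges, so the only
  loss comes from common back-neighbours, that is, from triangles.\<close>

lemma surplus_ge_back:
  assumes G: "finite_simple_graph G" and r: "inj_on r (verts G)"
    and D: "\<And>v. v \<in> verts G \<Longrightarrow> card (back_nbrs G r v) \<le> D"
    and g: "0 \<le> g" "g\<^sup>2 * real D \<le> 1 / 4"
  shows "(g * real (card (edges G)) / 8 - 2 * g\<^sup>2 * (\<Sum>v\<in>verts G. real (local_edges G (back_nbrs G r v)))) / 16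
      \<le> surplus G"
proof -
  let ?W = "verts G"
  \<comment> \<open>The squared norm is at most 2 (1/2)^2 + 2 g^2 D; the factor 1/2 here and the
    hypothesis on \<open>g\<close> give each summand half of the allowed 1.\<close>
  define a :: "'a \<Rightarrow> 'a \<Rightarrow> real" where "a v w = 1 / 2 * of_bool (w \<in> {v})" for v w
  define b :: "'a \<Rightarrow> 'a \<Rightarrow> real" where "b v w = g * of_bool (w \<in> back_nbrs G r v)" for v w
  have fin: "finite ?W" by (rule finite_verts[OF G])
  have "(\<Sum>(u, v)\<in>arcs G. (\<Sum>w\<in>?W. a u w * b v w) / 4 - (\<Sum>w\<in>?W. a u w * a v w)
           - (\<Sum>w\<in>?W. b u w * b v w)) / 16 \<le> surplus G"
  proof (rule surplus_ge_inner_products[OF G fin])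
    fix u v assume uv: "(u, v) \<in> arcs G"
    have "(\<Sum>w\<in>?W. (a u w + b v w)\<^sup>2) \<le> 2 * (1/2)\<^sup>2 * real (card {u}) + 2 * g\<^sup>2 * real (card (back_nbrs G r v))"
      unfolding a_def b_def using arcsD[OF G uv] back_subset[OF G, of r v]
      by (intro sum_weights_squared_le fin) auto
    also have "\<dots> \<le> 1/2 + 2 * g\<^sup>2 * real D"
      using D[OF arcsD(2)[OF G uv]] by (intro add_mono mult_left_mono) (auto simp: power2_eq_square)
    finally show "(\<Sum>w\<in>?W. (a u w + b v w)\<^sup>2) \<le> 1" using g(2) by simp
  qed (use g in \<open>auto simp: a_def b_def\<close>)
  also have "(\<Sum>(u, v)\<in>arcs G. (\<Sum>w\<in>?W. a u w * b v w) / 4 - (\<Sum>w\<in>?W. a u w * a v w)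
           - (\<Sum>w\<in>?W. b u w * b v w)) =
      (\<Sum>(u, v)\<in>arcs G. g / 8 * of_bool (u \<in> back_nbrs G r v) - g\<^sup>2 * real (card (back_nbrs G r u \<inter> back_nbrs G r v)))"
  proof (intro sum.cong refl, clarify)
    fix u v assume uv: "(u, v) \<in> arcs G"
    have "(\<Sum>w\<in>?W. a u w * b v w) = g / 2 * of_bool (u \<in> back_nbrs G r v)"
      unfolding a_def b_def using arcsD[OF G uv] by (subst sum_of_bool_mult[OF fin]) auto
    moreover have "(\<Sum>w\<in>?W. a u w * a v w) = 0"
      unfolding a_def using arcsD[OF G uv] by (subst sum_of_bool_mult[OF fin]) auto
    moreover have "(\<Sum>w\<in>?W. b u w * b v w) = g\<^sup>2 * real (card (back_nbrs G r u \<inter> back_nbrs G r v))"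
      unfolding b_def using back_subset[OF G, of r u]
      by (subst sum_of_bool_mult[OF fin]) (auto simp: power2_eq_square)
    ultimately show "(\<Sum>w\<in>?W. a u w * b v w) / 4 - (\<Sum>w\<in>?W. a u w * a v w) - (\<Sum>w\<in>?W. b u w * b v w)
        = g / 8 * of_bool (u \<in> back_nbrs G r v) - g\<^sup>2 * real (card (back_nbrs G r u \<inter> back_nbrs G r v))"
      by simp
  qed
  also have "\<dots> = g / 8 * (\<Sum>(u, v)\<in>arcs G. of_bool (u \<in> back_nbrs G r v))
      - g\<^sup>2 * (\<Sum>(u, v)\<in>arcs G. real (card (back_nbrs G r u \<inter> back_nbrs G r v)))"
    by (simp add: case_prod_unfold sum_subtractf sum_distrib_left)
  also have "(\<Sum>(u, v)\<in>arcs G. of_bool (u \<in> back_nbrs G r v)) = real (card (edges G))"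
    unfolding sum_arcs_back[OF G] sum_card_back[OF G r] ..
  finally have "(g / 8 * real (card (edges G))
      - g\<^sup>2 * (\<Sum>(u, v)\<in>arcs G. real (card (back_nbrs G r u \<inter> back_nbrs G r v)))) / 16 \<le> surplus G" .
  moreover have "g\<^sup>2 * (\<Sum>(u, v)\<in>arcs G. real (card (back_nbrs G r u \<inter> back_nbrs G r v)))
      \<le> g\<^sup>2 * (2 * (\<Sum>v\<in>verts G. real (local_edges G (back_nbrs G r v))))"
    by (intro mult_left_mono sum_common_back_le G r) auto
  ultimately show ?thesis by simp
qed

text \<open>Pairing neighbourhood vectors with a constant vector sums the squared degrees, which are
  bounded below through the average degree; the loss from common neighbours is a triangle
  count.\<close>

lemma surplus_ge_max_degree:
  assumes G: "finite_simple_graph G" and V: "verts G \<noteq> {}"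
    and deg: "\<And>v. v \<in> verts G \<Longrightarrow> real (card (nbrs G v)) \<le> \<Delta>" and \<Delta>: "0 < \<Delta>"
  shows "((real (card (edges G)) / real (card (verts G))) ^ 3 / 8
           - 2 * (\<Sum>w\<in>verts G. real (local_edges G (nbrs G w)))) / (64 * \<Delta>) \<le> surplus G"
proof -
  let ?W = "verts G"
  define m where "m = real (card (edges G))"
  define n where "n = real (card ?W)"
  define T where "T = (\<Sum>w\<in>?W. real (local_edges G (nbrs G w)))"
  define g where "g = sqrt (1 / (4 * \<Delta>))"
  \<comment> \<open>This \<open>t\<close> maximises t m^2 / n - 2 m n t^2, the gain from the degrees
    minus the cost of the constant vectors; the maximum is m^3 / (8 n^3).\<close>
  define t where "t = m / (4 * n\<^sup>2)"
  have fin: "finite ?W" by (rule finite_verts[OF G])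
  have n: "0 < n" unfolding n_def using fin V by (simp add: card_gt_0_iff)
  have m0: "0 \<le> m" by (simp add: m_def)
  have g2: "g\<^sup>2 = 1 / (4 * \<Delta>)" "0 \<le> g" using \<Delta> by (simp_all add: g_def)
  have t0: "0 \<le> t" using m0 by (simp add: t_def)
  have sum_deg: "(\<Sum>v\<in>?W. real (card (nbrs G v))) = 2 * m"
    using sum_card_nbrs[OF G] unfolding m_def by (metis of_nat_sum of_nat_mult of_nat_numeral)
  have "2 * m \<le> (\<Sum>v\<in>?W. \<Delta>)"
    unfolding sum_deg[symmetric] by (intro sum_mono deg)
  then have m1: "2 * m \<le> n * \<Delta>" by (simp add: n_def)
  have "2 * m \<le> (\<Sum>v\<in>?W. n)"
    unfolding sum_deg[symmetric] n_def using nbrs_subset[OF G] by (intro sum_mono) (simp add: card_mono[OF fin])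
  then have m2: "2 * m \<le> n * n" by (simp add: n_def)
  \<comment> \<open>Multiplying the two bounds on 2 m gives t^2 n \<le> \<Delta>, so the constant
    vectors and the neighbourhood vectors each take at most half of the allowed norm.\<close>
  have "(2 * m) * (2 * m) \<le> (n * \<Delta>) * (n * n)"
    using m1 m2 m0 n \<Delta> by (intro mult_mono[of "2 * m"]) auto
  moreover have "0 \<le> m * m" "0 \<le> \<Delta> * (n * (n * n))"
    using n \<Delta> by auto
  ultimately have "m * m \<le> 16 * (\<Delta> * (n * (n * n)))"
    by (simp add: algebra_simps)
  then have "t\<^sup>2 * n \<le> \<Delta>"
    using n \<Delta> by (simp add: t_def power2_eq_square field_simps)
  define a :: "'a \<Rightarrow> 'a \<Rightarrow> real" where "a v w = g * of_bool (w \<in> nbrs G v)" for v w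
  define b :: "'a \<Rightarrow> 'a \<Rightarrow> real" where "b v w = (t * g) * of_bool (w \<in> ?W)" for v w
  have "(\<Sum>(u, v)\<in>arcs G. (\<Sum>w\<in>?W. a u w * b v w) / 4 - (\<Sum>w\<in>?W. a u w * a v w)
           - (\<Sum>w\<in>?W. b u w * b v w)) / 16 \<le> surplus G"
  proof (rule surplus_ge_inner_products[OF G fin])
    fix u v assume uv: "(u, v) \<in> arcs G"
    have "(\<Sum>w\<in>?W. (a u w + b v w)\<^sup>2) \<le> 2 * g\<^sup>2 * real (card (nbrs G u)) + 2 * (t * g)\<^sup>2 * n"
      unfolding a_def b_def n_def using nbrs_subset[OF G, of u]
      by (intro sum_weights_squared_le fin) auto
    also have "\<dots> \<le> 2 * g\<^sup>2 * \<Delta> + 2 * g\<^sup>2 * (t\<^sup>2 * n)"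
      using deg[OF arcsD(1)[OF G uv]] by (intro add_mono mult_left_mono) (auto simp: power_mult_distrib)
    also have "\<dots> \<le> 2 * g\<^sup>2 * \<Delta> + 2 * g\<^sup>2 * \<Delta>"
      using \<open>t\<^sup>2 * n \<le> \<Delta>\<close> by (intro add_mono mult_left_mono) auto
    also have "\<dots> = 1" using \<Delta> by (simp add: g2)
    finally show "(\<Sum>w\<in>?W. (a u w + b v w)\<^sup>2) \<le> 1" .
  qed (use g2 t0 in \<open>auto simp: a_def b_def\<close>)
  also have "(\<Sum>(u, v)\<in>arcs G. (\<Sum>w\<in>?W. a u w * b v w) / 4 - (\<Sum>w\<in>?W. a u w * a v w)
           - (\<Sum>w\<in>?W. b u w * b v w)) =
      (\<Sum>(u, v)\<in>arcs G. t * g\<^sup>2 / 4 * real (card (nbrs G u))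
          - g\<^sup>2 * real (card (nbrs G u \<inter> nbrs G v)) - t\<^sup>2 * g\<^sup>2 * n)"
  proof (intro sum.cong refl, clarify)
    fix u v assume uv: "(u, v) \<in> arcs G"
    have N: "nbrs G u \<subseteq> ?W" by (rule nbrs_subset[OF G])
    then have "(\<Sum>w\<in>?W. a u w * b v w) = t * g\<^sup>2 * real (card (nbrs G u))"
      unfolding a_def b_def by (subst sum_of_bool_mult[OF fin]) (auto simp: Int_absorb2 power2_eq_square)
    moreover have "(\<Sum>w\<in>?W. a u w * a v w) = g\<^sup>2 * real (card (nbrs G u \<inter> nbrs G v))"
      unfolding a_def using N by (subst sum_of_bool_mult[OF fin]) (auto simp: power2_eq_square)
    moreover have "(\<Sum>w\<in>?W. b u w * b v w) = t\<^sup>2 * g\<^sup>2 * n"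
      unfolding b_def by (subst sum_of_bool_mult[OF fin]) (auto simp: power2_eq_square n_def)
    ultimately show "(\<Sum>w\<in>?W. a u w * b v w) / 4 - (\<Sum>w\<in>?W. a u w * a v w) - (\<Sum>w\<in>?W. b u w * b v w)
        = t * g\<^sup>2 / 4 * real (card (nbrs G u)) - g\<^sup>2 * real (card (nbrs G u \<inter> nbrs G v)) - t\<^sup>2 * g\<^sup>2 * n"
      by simp
  qed
  also have "\<dots> = t * g\<^sup>2 / 4 * (\<Sum>(u, v)\<in>arcs G. real (card (nbrs G u)))
      - g\<^sup>2 * (\<Sum>(u, v)\<in>arcs G. real (card (nbrs G u \<inter> nbrs G v))) - 2 * m * (t\<^sup>2 * g\<^sup>2 * n)"
    using card_arcs[OF G] by (simp add: case_prod_unfold sum_subtractf m_def sum_distrib_left)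
  also have "(\<Sum>(u, v)\<in>arcs G. real (card (nbrs G u))) = (\<Sum>v\<in>?W. (real (card (nbrs G v)))\<^sup>2)"
    by (subst sum_arcs_swap, subst sum_arcs[OF G]) (simp add: power2_eq_square)
  finally have main: "(t * g\<^sup>2 / 4 * (\<Sum>v\<in>?W. (real (card (nbrs G v)))\<^sup>2)
      - g\<^sup>2 * (2 * T) - 2 * m * (t\<^sup>2 * g\<^sup>2 * n)) / 16 \<le> surplus G"
    unfolding sum_common_nbrs[OF G] T_def .
  \<comment> \<open>\<open>c\<close> is the mean degree; nonnegativity of the variance is the
    Cauchy-Schwarz bound on the squared degrees.\<close>
  define c where "c = 2 * m / n"
  have "0 \<le> (\<Sum>v\<in>?W. (real (card (nbrs G v)) - c)\<^sup>2)" by (intro sum_nonneg) auto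
  also have "\<dots> = (\<Sum>v\<in>?W. (real (card (nbrs G v)))\<^sup>2) - 2 * c * (2 * m) + n * c\<^sup>2"
    unfolding power2_diff sum.distrib sum_subtractf sum_deg[symmetric]
    by (simp add: sum_distrib_left n_def algebra_simps)
  also have "\<dots> = (\<Sum>v\<in>?W. (real (card (nbrs G v)))\<^sup>2) - 4 * m\<^sup>2 / n"
    using n by (simp add: c_def power2_eq_square field_simps)
  finally have sq: "4 * m\<^sup>2 / n \<le> (\<Sum>v\<in>?W. (real (card (nbrs G v)))\<^sup>2)"
    by simp
  have "((m / n) ^ 3 / 8 - 2 * T) / (64 * \<Delta>) =
      (t * g\<^sup>2 / 4 * (4 * m\<^sup>2 / n) - g\<^sup>2 * (2 * T) - 2 * m * (t\<^sup>2 * g\<^sup>2 * n)) / 16"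
    unfolding g2 t_def using n \<Delta> by (simp add: power2_eq_square power3_eq_cube field_simps)
  also have "\<dots> \<le> (t * g\<^sup>2 / 4 * (\<Sum>v\<in>?W. (real (card (nbrs G v)))\<^sup>2)
      - g\<^sup>2 * (2 * T) - 2 * m * (t\<^sup>2 * g\<^sup>2 * n)) / 16"
    using sq t0 by (intro divide_right_mono diff_right_mono mult_left_mono) auto
  also note main
  finally show ?thesis by (simp add: m_def n_def T_def)
qed

section \<open>Locally sparse graphs\<close>

text \<open>All subsets of a neighbourhood are included, so the property covers sets of
  back-neighbours and passes to induced subgraphs.\<close>

definition locally_sparse :: "'a graph \<Rightarrow> real \<Rightarrow> real \<Rightarrow> bool" where
  "locally_sparse G C \<epsilon> \<longleftrightarrow>
     (\<forall>w\<in>verts G. \<forall>S\<subseteq>nbrs G w. real (local_edges G S) \<le> C * real (card S) powr (2 - \<epsilon>))"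

lemma locally_sparse_induce:
  assumes "locally_sparse G C \<epsilon>" "T \<subseteq> verts G"
  shows "locally_sparse (induce G T) C \<epsilon>"
  using assms unfolding locally_sparse_def local_edges_def
  by (auto simp: nbrs_induce induce_induce)

lemma back_nbrs_induce_subset: "v \<in> S \<Longrightarrow> back_nbrs (induce G S) r v \<subseteq> back_nbrs G r v"
  by (auto simp: back_nbrs_def nbrs_induce)

lemma card_back_nbrs_induce_le:
  assumes "finite_simple_graph G" "v \<in> S"
  shows "card (back_nbrs (induce G S) r v) \<le> card (back_nbrs G r v)"
  using assms by (intro card_mono finite_back back_nbrs_induce_subset)

text \<open>One factor of |S|^(2 - \<epsilon>) is kept for the sum and the remaining |S|^(1 -
  \<epsilon>) is bounded through \<open>D\<close>.\<close>

lemma sum_local_edges_le: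
  assumes sp: "locally_sparse G C \<epsilon>" and "\<epsilon> \<le> 1" "0 \<le> C"
    and S: "\<And>w. w \<in> verts G \<Longrightarrow> S w \<subseteq> nbrs G w \<and> real (card (S w)) \<le> D"
  shows "(\<Sum>w\<in>verts G. real (local_edges G (S w))) \<le> C * D powr (1 - \<epsilon>) * (\<Sum>w\<in>verts G. real (card (S w)))"
proof -
  have "real (local_edges G (S w)) \<le> C * D powr (1 - \<epsilon>) * real (card (S w))" if w: "w \<in> verts G" for w
  proof -
    let ?c = "real (card (S w))"
    have "real (local_edges G (S w)) \<le> C * ?c powr ((1 - \<epsilon>) + 1)"
      using sp S[OF w] w unfolding locally_sparse_def by (simp add: algebra_simps)
    also have "\<dots> = C * (?c powr (1 - \<epsilon>) * ?c)"
      by (subst powr_add) simp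
    also have "\<dots> \<le> C * (D powr (1 - \<epsilon>) * ?c)"
      using assms(2,3) S[OF w] by (intro mult_left_mono mult_right_mono powr_mono2) auto
    finally show ?thesis by (simp add: mult.assoc)
  qed
  then show ?thesis
    unfolding sum_distrib_left by (intro sum_mono)
qed

lemma surplus_ge_degenerate:
  assumes G: "finite_simple_graph G" and r: "inj_on r (verts G)"
    and deg_back: "\<And>v. v \<in> verts G \<Longrightarrow> card (back_nbrs G r v) \<le> D" and D: "1 \<le> D"
    and sp: "locally_sparse G C \<epsilon>" and C: "1 \<le> C" and \<epsilon>: "\<epsilon> \<le> 1" and \<tau>: "\<tau> \<le> \<epsilon>" "\<tau> \<le> 1 / 2"
  shows "real (card (edges G)) * real D powr (\<tau> - 1) / (2 ^ 14 * C) \<le> surplus G"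
proof -
  define m where "m = real (card (edges G))"
  define d where "d = real D"
  define T where "T = (\<Sum>v\<in>verts G. real (local_edges G (back_nbrs G r v)))"
  \<comment> \<open>With this \<open>g\<close> the triangle loss 2 g^2 T is at most g m / 32, a
    quarter of the gain g m / 8. The bound \<tau> \<le> \<epsilon> controls \<open>T\<close>, and
    \<tau> \<le> 1/2 gives g^2 d \<le> 1/4.\<close>
  define g where "g = d powr (\<tau> - 1) / (64 * C)"
  have d: "1 \<le> d" using D by (simp add: d_def)
  have m: "0 \<le> m" by (simp add: m_def)
  have g0: "0 \<le> g" using C by (simp add: g_def)
  have "g\<^sup>2 * d = d powr (2 * \<tau> - 1) / (64 * C)\<^sup>2"
  proof -
    have "(d powr (\<tau> - 1))\<^sup>2 * d = d powr ((\<tau> - 1) + (\<tau> - 1) + 1)"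
      using d unfolding powr_add by (simp add: power2_eq_square)
    then show ?thesis by (simp add: g_def power_divide algebra_simps)
  qed
  also have "\<dots> \<le> 1 / (64 * C)\<^sup>2"
  proof (rule divide_right_mono)
    have "d powr (2 * \<tau> - 1) \<le> d powr 0" using d \<tau> by (intro powr_mono) auto
    then show "d powr (2 * \<tau> - 1) \<le> 1" using d by simp
  qed simp
  also have "\<dots> \<le> 1 / 4"
  proof -
    have "(2::real)\<^sup>2 \<le> (64 * C)\<^sup>2" using C by (intro power_mono) auto
    then show ?thesis by (intro divide_left_mono) auto
  qed
  finally have g1: "g\<^sup>2 * real D \<le> 1 / 4" by (simp add: d_def)
  have "T \<le> C * d powr (1 - \<epsilon>) * m"
    unfolding T_def m_def sum_card_back[OF G r, symmetric] d_def
    using deg_back C by (intro sum_local_edges_le[OF sp \<epsilon>]) (auto simp: back_nbrs_def)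
  also have "\<dots> \<le> C * d powr (1 - \<tau>) * m"
    using C d \<tau> m by (intro mult_right_mono mult_left_mono powr_mono) auto
  finally have "g * T \<le> g * (C * d powr (1 - \<tau>) * m)"
    using g0 by (intro mult_left_mono)
  also have "\<dots> = (d powr (\<tau> - 1) * d powr (1 - \<tau>)) * m / 64"
    using C by (simp add: g_def)
  also have "\<dots> = m / 64"
    using d by (simp flip: powr_add)
  finally have "g * (g * T) \<le> g * (m / 64)"
    using g0 by (intro mult_left_mono)
  then have "2 * g\<^sup>2 * T \<le> g * m / 32"
    by (simp add: power2_eq_square mult.assoc)
  moreover have "(g * m / 8 - 2 * g\<^sup>2 * T) / 16 \<le> surplus G"
    unfolding m_def T_def by (rule surplus_ge_back[OF G r deg_back g0 g1])
  moreover have "0 \<le> g * m" using g0 m by simp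
  ultimately have "g * m / 256 \<le> surplus G" by (simp add: field_simps)
  then show ?thesis
    by (simp add: g_def m_def d_def field_simps)
qed

text \<open>The set \<open>Q\<close> of vertices of degree above \<open>16 D\<close> spans few edges by degeneracy. So either most edges
  join \<open>Q\<close> to its complement \<open>L\<close>, which is then already a good cut, or \<open>L\<close> spans a constant
  proportion of the edges and has bounded degree.\<close>

lemma surplus_ge_dense:
  assumes G: "finite_simple_graph G" and r: "inj_on r (verts G)"
    and deg_back: "\<And>v. v \<in> verts G \<Longrightarrow> card (back_nbrs G r v) \<le> D" and D: "1 \<le> D"
    and V: "verts G \<noteq> {}" and deg: "\<And>v. v \<in> verts G \<Longrightarrow> D \<le> card (nbrs G v)"
    and sp: "locally_sparse G C \<epsilon>" and C: "1 \<le> C" and \<epsilon>: "0 \<le> \<epsilon>" "\<epsilon> \<le> 1"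
    and small: "real (card (verts G)) \<le> real D powr (1 + \<epsilon>) / (2 ^ 22 * C)"
  shows "(real D)\<^sup>2 / 2 ^ 26 \<le> surplus G"
proof -
  define m where "m = card (edges G)"
  define n where "n = card (verts G)"
  define Q where "Q = {v \<in> verts G. 16 * D < card (nbrs G v)}"
  define L where "L = verts G - Q"
  have fin: "finite (verts G)" by (rule finite_verts[OF G])
  have QV: "Q \<subseteq> verts G" and LV: "L \<subseteq> verts G" by (auto simp: Q_def L_def)
  have GL: "finite_simple_graph (induce G L)" and GQ: "finite_simple_graph (induce G Q)"
    using finite_simple_graph_induce[OF G] QV LV by auto
  have sumdeg: "(\<Sum>v\<in>verts G. card (nbrs G v)) = 2 * m"
    unfolding m_def by (rule sum_card_nbrs[OF G])
  have "(\<Sum>v\<in>verts G. D) \<le> 2 * m"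
    unfolding sumdeg[symmetric] by (intro sum_mono deg)
  then have nD: "n * D \<le> 2 * m" by (simp add: n_def)
  have mn: "m \<le> n * D"
    unfolding m_def n_def by (rule card_edges_le_back[OF G r deg_back])
  have "D \<le> n"
  proof -
    obtain v where "v \<in> verts G" using V by auto
    then have "D \<le> card (nbrs G v)" by (rule deg)
    also have "\<dots> \<le> n" unfolding n_def by (intro card_mono fin nbrs_subset G)
    finally show ?thesis .
  qed
  \<comment> \<open>The degree sum bounds |Q| D by m / 8, and by degeneracy \<open>Q\<close> spans
    at most |Q| D edges.\<close>
  have "(\<Sum>v\<in>Q. 16 * D) \<le> (\<Sum>v\<in>Q. card (nbrs G v))"
    by (intro sum_mono) (auto simp: Q_def)
  also have "\<dots> \<le> 2 * m"
    unfolding sumdeg[symmetric] by (intro sum_mono2 fin QV) auto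
  finally have "8 * (card Q * D) \<le> m" by (simp add: mult.commute)
  moreover have "local_edges G Q \<le> card Q * D"
  proof -
    have "card (edges (induce G Q)) \<le> card (verts (induce G Q)) * D"
    proof (rule card_edges_le_back[OF GQ])
      show "inj_on r (verts (induce G Q))" using inj_on_subset[OF r QV] by simp
      show "card (back_nbrs (induce G Q) r v) \<le> D" if "v \<in> verts (induce G Q)" for v
        using that QV card_back_nbrs_induce_le[OF G, of v Q r] deg_back[of v] by fastforce
    qed
    then show ?thesis by (simp add: local_edges_def)
  qed
  ultimately have eQ: "8 * local_edges G Q \<le> m" by linarith
  have "edges G \<subseteq> cut_edges G L \<union> (edges (induce G L) \<union> edges (induce G Q))"
    using G by (auto simp: cut_edges_def induce_def L_def finite_simple_graph_def)
  then have "m \<le> card (cut_edges G L \<union> (edges (induce G L) \<union> edges (induce G Q)))"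
    unfolding m_def using finite_edges[OF G]
    by (intro card_mono) (auto simp: cut_edges_def induce_def)
  also have "\<dots> \<le> card (cut_edges G L) + (local_edges G L + local_edges G Q)"
    unfolding local_edges_def by (meson add_left_mono card_Un_le order_trans)
  finally have cut: "m \<le> card (cut_edges G L) + (local_edges G L + local_edges G Q)" .
  show ?thesis
  proof (cases "8 * local_edges G L < m")
    case True
    \<comment> \<open>At least 3 m / 4 edges cross the cut, so the surplus is at least m / 4, while
      m \<ge> D^2 / 2.\<close>
    have "D * D \<le> n * D" using \<open>D \<le> n\<close> by simp
    then have "D * D \<le> 2 * m" using nD by linarith
    moreover have "3 * m \<le> 4 * max_cut G"
      using cut eQ True card_cut_edges_le_max_cut[OF G LV] by linarith
    ultimately have "real (D * D) \<le> real (2 * m)" "real (3 * m) \<le> real (4 * max_cut G)"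
      by (auto simp only: of_nat_mono)
    then have "real D * real D \<le> 8 * surplus G"
      unfolding surplus_def m_def[symmetric] by simp
    then show ?thesis
      using surplus_nonneg[OF G] by (simp add: power2_eq_square)
  next
    case False
    let ?F = "induce G L"
    define mL where "mL = real (card (edges ?F))"
    define nL where "nL = real (card L)"
    define d where "d = real D"
    define T where "T = (\<Sum>w\<in>verts ?F. real (local_edges ?F (nbrs ?F w)))"
    have d: "1 \<le> d" using D by (simp add: d_def)
    have mL: "real m \<le> 8 * mL" "mL \<le> real m"
      using False card_mono[OF finite_edges[OF G], of "edges ?F"]
      by (auto simp: mL_def local_edges_def m_def induce_def)
    have "0 < n * D" using D \<open>D \<le> n\<close> by simp
    then have "0 < mL" using mL nD by linarith
    have "L \<noteq> {}"
    proof
      assume "L = {}"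
      then have "edges ?F = {}" using G by (auto simp: induce_def finite_simple_graph_def)
      then show False using \<open>0 < mL\<close> by (simp add: mL_def)
    qed
    then have nL: "0 < nL" "nL \<le> real n"
      using fin LV by (auto simp: nL_def n_def card_gt_0_iff card_mono intro: finite_subset)
    have degF: "real (card (nbrs ?F v)) \<le> 16 * d" if "v \<in> L" for v
    proof -
      have "card (nbrs ?F v) \<le> card (nbrs G v)"
        using that by (intro card_mono finite_nbrs G) (auto simp: nbrs_induce)
      also have "\<dots> \<le> 16 * D" using that by (auto simp: L_def Q_def)
      finally show ?thesis unfolding d_def by linarith
    qed
    have bound: "((mL / nL) ^ 3 / 8 - 2 * T) / (64 * (16 * d)) \<le> surplus ?F"
      using surplus_ge_max_degree[OF GL, of "16 * d"] degF \<open>L \<noteq> {}\<close> d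
      by (simp add: mL_def nL_def T_def)
    \<comment> \<open>Keeping an eighth of the edges on no more vertices, \<open>L\<close> spans a
      graph with mL / nL \<ge> d / 16.\<close>
    have "real (n * D) \<le> real (2 * m)" using nD by (rule of_nat_mono)
    then have "real n * d \<le> 2 * real m" by (simp add: d_def)
    moreover have "nL * d \<le> real n * d" using nL d by (intro mult_right_mono) auto
    ultimately have "nL * d \<le> 16 * mL" using mL by linarith
    then have "d / 16 \<le> mL / nL" using nL by (simp add: field_simps)
    then have "(d / 16) ^ 3 \<le> (mL / nL) ^ 3" using d by (intro power_mono) auto
    then have cube: "d ^ 3 / 4096 \<le> (mL / nL) ^ 3" by (simp add: power_divide)
    \<comment> \<open>The bound on the number of vertices gives T \<le> d^3 / 2^17, so the loss 2 T
      is at most half of the gain d^3 / 2^15.\<close>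
    have "T \<le> C * (16 * d) powr (1 - \<epsilon>) * (\<Sum>w\<in>verts ?F. real (card (nbrs ?F w)))"
      unfolding T_def using C \<epsilon> degF
      by (intro sum_local_edges_le[OF locally_sparse_induce[OF sp LV]]) auto
    also have "(\<Sum>w\<in>verts ?F. real (card (nbrs ?F w))) = 2 * mL"
      using sum_card_nbrs[OF GL] unfolding mL_def by (metis of_nat_sum of_nat_mult of_nat_numeral)
    also have "C * (16 * d) powr (1 - \<epsilon>) * (2 * mL) \<le> C * (16 * d powr (1 - \<epsilon>)) * (2 * (real n * d))"
    proof (intro mult_mono mult_left_mono)
      have "(16::real) powr (1 - \<epsilon>) \<le> 16 powr 1" using \<epsilon> by (intro powr_mono) auto
      then have "(16::real) powr (1 - \<epsilon>) * d powr (1 - \<epsilon>) \<le> 16 * d powr (1 - \<epsilon>)"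
        by (intro mult_right_mono) auto
      then show "(16 * d) powr (1 - \<epsilon>) \<le> 16 * d powr (1 - \<epsilon>)"
        using d by (simp add: powr_mult)
      have "real m \<le> real (n * D)" using mn by (rule of_nat_mono)
      then show "mL \<le> real n * d" using mL by (simp add: d_def)
    qed (use C \<open>0 < mL\<close> in auto)
    also have "\<dots> = 32 * C * d powr (1 - \<epsilon>) * d * real n" by simp
    also have "\<dots> \<le> 32 * C * d powr (1 - \<epsilon>) * d * (d powr (1 + \<epsilon>) / (2 ^ 22 * C))"
      using small C d unfolding n_def d_def by (intro mult_left_mono) auto
    also have "\<dots> = (d powr (1 - \<epsilon>) * d powr (1 + \<epsilon>)) * d / 2 ^ 17"
      using C by (simp add: field_simps)
    also have "d powr (1 - \<epsilon>) * d powr (1 + \<epsilon>) = d\<^sup>2"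
      using d by (simp flip: powr_add add: powr_numeral)
    finally have "T \<le> d ^ 3 / 2 ^ 17" by (simp add: power2_eq_square power3_eq_cube)
    with cube have "d ^ 3 / 2 ^ 16 \<le> (mL / nL) ^ 3 / 8 - 2 * T" by simp
    then have "(d ^ 3 / 2 ^ 16) / (64 * (16 * d)) \<le> ((mL / nL) ^ 3 / 8 - 2 * T) / (64 * (16 * d))"
      using d by (intro divide_right_mono) auto
    also note bound
    also have "surplus ?F \<le> surplus G" by (rule surplus_induce_le[OF G LV])
    also have "(d ^ 3 / 2 ^ 16) / (64 * (16 * d)) = d\<^sup>2 / 2 ^ 26"
      using d by (simp add: power2_eq_square power3_eq_cube)
    finally show ?thesis by (simp add: d_def)
  qed
qed

text \<open>With few vertices the dense bound gives order d^2, which suffices as \<tau> \<le> 1/2.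
  With many, m \<ge> n d / 2 turns the degenerate bound m d^(\<tau> - 1) into order d^(1 +
  \<epsilon> + \<tau>), which suffices as \<tau> \<le> \<epsilon>.\<close>

lemma surplus_ge_min_degree:
  assumes G: "finite_simple_graph G" and r: "inj_on r (verts G)"
    and deg_back: "\<And>v. v \<in> verts G \<Longrightarrow> card (back_nbrs G r v) \<le> D" and D: "1 \<le> D"
    and V: "verts G \<noteq> {}" and deg: "\<And>v. v \<in> verts G \<Longrightarrow> D \<le> card (nbrs G v)"
    and sp: "locally_sparse G C \<epsilon>" and C: "1 \<le> C" and \<epsilon>: "0 \<le> \<epsilon>" "\<epsilon> \<le> 1"
    and \<tau>: "\<tau> \<le> \<epsilon>" "\<tau> \<le> 1 / 2"
  shows "real D powr (1 + 2 * \<tau>) / (2 ^ 37 * C\<^sup>2) \<le> surplus G"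
proof -
  define d where "d = real D"
  define n where "n = real (card (verts G))"
  have d: "1 \<le> d" using D by (simp add: d_def)
  have C2: "1 \<le> C\<^sup>2" using C by simp
  show ?thesis
  proof (cases "n \<le> d powr (1 + \<epsilon>) / (2 ^ 22 * C)")
    case True
    have "d powr (1 + 2 * \<tau>) \<le> d powr 2" using d \<tau> by (intro powr_mono) auto
    also have "\<dots> = d\<^sup>2" using d by (simp add: powr_numeral)
    finally have "d powr (1 + 2 * \<tau>) / (2 ^ 37 * C\<^sup>2) \<le> d\<^sup>2 / 2 ^ 26"
      using C2 by (intro frac_le) auto
    also have "\<dots> \<le> surplus G"
      using surplus_ge_dense[OF G r deg_back D V deg sp C \<epsilon>] True by (simp add: d_def n_def)
    finally show ?thesis by (simp add: d_def)
  next
    case False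
    have "(\<Sum>v\<in>verts G. D) \<le> 2 * card (edges G)"
      unfolding sum_card_nbrs[OF G, symmetric] by (intro sum_mono deg)
    then have "card (verts G) * D \<le> 2 * card (edges G)" by simp
    then have "real (card (verts G) * D) \<le> real (2 * card (edges G))" by (rule of_nat_mono)
    then have m: "n * d / 2 \<le> real (card (edges G))" by (simp add: n_def d_def)
    have "d powr (1 + 2 * \<tau>) \<le> d powr (1 + \<epsilon> + \<tau>)"
      using d \<tau> by (intro powr_mono) auto
    also have "\<dots> = d powr (1 + \<epsilon>) * (d * d powr (\<tau> - 1))"
    proof -
      have "d * d powr (\<tau> - 1) = d powr \<tau>" using d powr_add[of d 1 "\<tau> - 1"] by simp
      then show ?thesis by (simp only: powr_add)
    qed
    finally have "d powr (1 + 2 * \<tau>) / (2 ^ 37 * C\<^sup>2)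
        \<le> d powr (1 + \<epsilon>) * (d * d powr (\<tau> - 1)) / (2 ^ 37 * C\<^sup>2)"
      by (intro divide_right_mono) auto
    also have "\<dots> = d powr (1 + \<epsilon>) / (2 ^ 22 * C) * (d / 2 * d powr (\<tau> - 1) / (2 ^ 14 * C))"
      by (simp add: power2_eq_square)
    also have "\<dots> \<le> n * (d / 2 * d powr (\<tau> - 1) / (2 ^ 14 * C))"
      using False d C by (intro mult_right_mono) auto
    also have "\<dots> = (n * d / 2) * d powr (\<tau> - 1) / (2 ^ 14 * C)" by simp
    also have "\<dots> \<le> real (card (edges G)) * d powr (\<tau> - 1) / (2 ^ 14 * C)"
      using m C by (intro divide_right_mono mult_right_mono) auto
    also have "\<dots> \<le> surplus G"
      unfolding d_def by (rule surplus_ge_degenerate[OF G r deg_back D sp C \<epsilon>(2) \<tau>])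
    finally show ?thesis by (simp add: d_def)
  qed
qed

section \<open>Degenerate orders and subgraphs of large minimum degree\<close>

lemma degenerate_order:
  assumes G: "finite_simple_graph G"
    and D: "\<And>S. S \<subseteq> verts G \<Longrightarrow> S \<noteq> {} \<Longrightarrow> \<exists>v\<in>S. card (nbrs G v \<inter> S) \<le> D"
  obtains r where "inj_on r (verts G)" "\<And>v. v \<in> verts G \<Longrightarrow> card (back_nbrs G r v) \<le> D"
proof -
  have "\<exists>r. inj_on r U \<and> (\<forall>v\<in>U. r v < card U) \<and> (\<forall>v\<in>U. card {u \<in> nbrs G v \<inter> U. r u < r v} \<le> D)"
    if "U \<subseteq> verts G" for U
    using that
  proof (induction "card U" arbitrary: U)
    case 0
    then have "U = {}" using finite_subset[OF _ finite_verts[OF G]] by auto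
    then show ?case by simp
  next
    case (Suc k)
    then have "U \<noteq> {}" "finite U" using finite_subset[OF _ finite_verts[OF G]] by auto
    then obtain v where v: "v \<in> U" "card (nbrs G v \<inter> U) \<le> D" using D Suc.prems by blast
    have k: "card (U - {v}) = k" using v Suc.hyps(2) \<open>finite U\<close> by simp
    have "U - {v} \<subseteq> verts G" using Suc.prems by auto
    from Suc.hyps(1)[OF k[symmetric] this]
    obtain r where r: "inj_on r (U - {v})" "\<forall>u\<in>U - {v}. r u < k"
      "\<forall>w\<in>U - {v}. card {u \<in> nbrs G w \<inter> (U - {v}). r u < r w} \<le> D"
      unfolding k by blast
    \<comment> \<open>The vertex of small degree in \<open>U\<close> is ranked last; the others have
      ranks below \<open>k\<close>, so their back-neighbours are unchanged.\<close>
    let ?r = "r(v := k)"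
    have "inj_on ?r U"
      using r(1,2) by (fastforce simp: inj_on_def)
    moreover have "\<forall>u\<in>U. ?r u < card U"
      using r(2) by (auto simp flip: Suc.hyps(2) intro: less_SucI)
    moreover have "card {u \<in> nbrs G w \<inter> U. ?r u < ?r w} \<le> D" if w: "w \<in> U" for w
    proof (cases "w = v")
      case True
      have "card {u \<in> nbrs G w \<inter> U. ?r u < ?r w} \<le> card (nbrs G v \<inter> U)"
        using True \<open>finite U\<close> by (intro card_mono) auto
      then show ?thesis using v by linarith
    next
      case False
      then have "{u \<in> nbrs G w \<inter> U. ?r u < ?r w} = {u \<in> nbrs G w \<inter> (U - {v}). r u < r w}"
        using r(2) w by force
      then show ?thesis using r(3) w False by simp
    qed
    ultimately show ?case by blast
  qed
  from this[OF subset_refl] obtain r :: "'a \<Rightarrow> nat" where r: "inj_on r (verts G)"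
    "\<forall>v\<in>verts G. card {u \<in> nbrs G v \<inter> verts G. r u < r v} \<le> D"
    by blast
  moreover have "{u \<in> nbrs G v \<inter> verts G. r u < r v} = back_nbrs G r v" for v
    using nbrs_subset[OF G, of v] by (auto simp: back_nbrs_def)
  ultimately show thesis using that by metis
qed

text \<open>\<open>D\<close> is the least bound for which every nonempty set has a vertex of small
  inner degree. Leastness yields a set violating the bound D - 1, whose inner degrees are all at
  least \<open>D\<close>; the ends of an edge exclude D = 0.\<close>

lemma degeneracy:
  assumes G: "finite_simple_graph G" and E: "edges G \<noteq> {}"
  obtains D r S where "1 \<le> D" "inj_on r (verts G)" "\<And>v. v \<in> verts G \<Longrightarrow> card (back_nbrs G r v) \<le> D"
    "S \<subseteq> verts G" "S \<noteq> {}" "\<And>v. v \<in> S \<Longrightarrow> D \<le> card (nbrs G v \<inter> S)"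
proof -
  define P where "P D \<longleftrightarrow> (\<forall>S\<subseteq>verts G. S \<noteq> {} \<longrightarrow> (\<exists>v\<in>S. card (nbrs G v \<inter> S) \<le> D))" for D
  define D where "D = (LEAST D. P D)"
  have "P (card (verts G))"
    unfolding P_def
  proof (intro allI impI)
    fix S assume S: "S \<subseteq> verts G" "S \<noteq> {}"
    then obtain v where "v \<in> S" by auto
    moreover have "card (nbrs G v \<inter> S) \<le> card (verts G)"
      using S finite_verts[OF G] by (intro card_mono) auto
    ultimately show "\<exists>v\<in>S. card (nbrs G v \<inter> S) \<le> card (verts G)" by blast
  qed
  then have PD: "P D" unfolding D_def by (rule LeastI)
  have "\<not> P 0"
  proof
    assume P0: "P 0"
    obtain e where e: "e \<in> edges G" using E by auto
    then obtain u v where uv: "e = {u, v}" "u \<noteq> v" "e \<subseteq> verts G"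
      using G by (auto simp: finite_simple_graph_def card_2_iff)
    have "nbrs G w \<inter> e \<noteq> {}" if "w \<in> e" for w
      using that e uv(1) by (auto simp: nbrs_def insert_commute)
    moreover have "finite e" using uv(1) by simp
    ultimately have pos: "card (nbrs G w \<inter> e) \<noteq> 0" if "w \<in> e" for w
      using that by simp
    have "e \<noteq> {}" using uv(1) by simp
    then obtain w where "w \<in> e" "card (nbrs G w \<inter> e) \<le> 0"
      using P0[unfolded P_def, rule_format, OF uv(3)] by blast
    then show False using pos[of w] by simp
  qed
  then have "D \<noteq> 0" using PD by metis
  then obtain k where k: "D = Suc k" using not0_implies_Suc by auto
  then have "\<not> P k" unfolding D_def by (intro not_less_Least) simp
  then obtain S where S: "S \<subseteq> verts G" "S \<noteq> {}" "\<And>v. v \<in> S \<Longrightarrow> D \<le> card (nbrs G v \<inter> S)"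
    unfolding P_def k by (auto simp: not_le Suc_le_eq)
  obtain r where "inj_on r (verts G)" "\<And>v. v \<in> verts G \<Longrightarrow> card (back_nbrs G r v) \<le> D"
    using degenerate_order[OF G, of D] PD unfolding P_def by blast
  with S k show thesis by (intro that[of D r S]) auto
qed

section \<open>Graphs without a forbidden subgraph\<close>

lemma free_of_induce:
  assumes "free_of H G" "S \<subseteq> verts G"
  shows "free_of H (induce G S)"
  using assms unfolding free_of_def contains_copy_def by (fastforce simp: induce_def)

text \<open>A copy of H - v among the neighbours of \<open>w\<close> would extend to a copy of H by
  sending \<open>v\<close> to \<open>w\<close>.\<close>

lemma free_of_delete_vertex_nbrs:
  assumes G: "finite_simple_graph G" and H: "finite_simple_graph H" and v: "v \<in> verts H"
    and free: "free_of H G" and w: "w \<in> verts G" and S: "S \<subseteq> nbrs G w"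
  shows "free_of (delete_vertex H v) (induce G S)"
  unfolding free_of_def
proof
  assume "contains_copy (delete_vertex H v) (induce G S)"
  then obtain f where f: "inj_on f (verts H - {v})" "f ` (verts H - {v}) \<subseteq> S"
    "\<And>e. e \<in> edges H \<Longrightarrow> v \<notin> e \<Longrightarrow> f ` e \<in> edges G"
    unfolding contains_copy_def delete_vertex_def by (auto simp: induce_def)
  have "w \<notin> nbrs G w" using arcsD(3)[OF G] by (auto simp flip: arcs_iff_nbrs)
  then have wS: "w \<notin> f ` (verts H - {v})" using f(2) S by auto
  let ?g = "f(v := w)"
  have "inj_on ?g (verts H)"
    using f(1) wS by (fastforce simp: inj_on_def)
  moreover have "?g ` verts H \<subseteq> verts G"
    using f(2) S w nbrs_subset[OF G, of w] by fastforce
  moreover have "?g ` e \<in> edges G" if e: "e \<in> edges H" for e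
  proof (cases "v \<in> e")
    case False
    then have "?g ` e = f ` e" by auto
    then show ?thesis using f(3)[OF e False] by simp
  next
    case True
    have "card e = 2" "e \<subseteq> verts H" using e H by (auto simp: finite_simple_graph_def)
    then obtain u where u: "e = {u, v}" "u \<noteq> v"
      using True by (auto simp: card_2_iff)
    then have "f u \<in> nbrs G w" using f(2) S \<open>e \<subseteq> verts H\<close> by auto
    then show ?thesis using u by (simp add: nbrs_def)
  qed
  ultimately have "contains_copy H G" unfolding contains_copy_def by blast
  then show False using free by (simp add: free_of_def)
qed

lemma card_edges_le_ex_num:
  fixes G :: "nat graph"
  assumes "finite_simple_graph G" "free_of F G"
  shows "card (edges G) \<le> ex_num (card (verts G)) F"
proof -
  let ?S = "{card (edges G') | G' :: nat graph.
    finite_simple_graph G' \<and> card (verts G') = card (verts G) \<and> free_of F G'}"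
  have mem: "card (edges G) \<in> ?S" using assms by auto
  then have "?S \<noteq> {}" by blast
  from ex_num_eq_Max[OF this] mem show ?thesis by simp
qed

text \<open>The asymptotic bound becomes uniform by adding 2^N, which bounds the edges of any graph
  on fewer than \<open>N\<close> vertices. The empty graph is separate because
  \<open>0 powr p = 0\<close>.\<close>

lemma ex_num_bigo_imp_card_edges_le:
  assumes O: "(\<lambda>n. real (ex_num n F)) \<in> O(\<lambda>n. real n powr p)" and p: "0 \<le> p"
  obtains C where "1 \<le> C" "\<And>G :: nat graph. finite_simple_graph G \<Longrightarrow> free_of F G \<Longrightarrow>
    real (card (edges G)) \<le> C * real (card (verts G)) powr p"
proof -
  obtain c where c: "c > 0" "eventually (\<lambda>n. norm (real (ex_num n F)) \<le> c * norm (real n powr p)) sequentially"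
    using O by (rule landau_o.bigE)
  then obtain N where N: "\<And>n. N \<le> n \<Longrightarrow> real (ex_num n F) \<le> c * real n powr p"
    by (auto simp: eventually_sequentially)
  have "real (card (edges G)) \<le> (c + 2 ^ N) * real (card (verts G)) powr p"
    if G: "finite_simple_graph G" "free_of F G" for G :: "nat graph"
  proof -
    define n where "n = card (verts G)"
    have Pow: "edges G \<subseteq> Pow (verts G)" using G by (auto simp: finite_simple_graph_def)
    consider "N \<le> n" | "n = 0" | "0 < n" "n < N" by linarith
    then show ?thesis
    proof cases
      case 1
      have "real (card (edges G)) \<le> real (ex_num n F)"
        unfolding n_def using card_edges_le_ex_num[OF G] by simp
      also have "\<dots> \<le> c * real n powr p" by (rule N[OF 1])
      also have "\<dots> \<le> (c + 2 ^ N) * real n powr p" by (intro mult_right_mono) auto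
      finally show ?thesis by (simp add: n_def)
    next
      case 2
      then have "verts G = {}" using finite_verts[OF G(1)] by (simp add: n_def)
      then have "edges G = {}" using G(1) by (auto simp: finite_simple_graph_def)
      then show ?thesis using c by simp
    next
      case 3
      have "card (edges G) \<le> 2 ^ n"
        using card_mono[OF _ Pow] finite_verts[OF G(1)] by (simp add: card_Pow n_def)
      also have "\<dots> \<le> 2 ^ N" using 3 by (intro power_increasing) auto
      finally have "real (card (edges G)) \<le> 2 ^ N" by (metis of_nat_le_iff of_nat_numeral of_nat_power)
      also have "\<dots> \<le> (c + 2 ^ N) * 1" using c by simp
      also have "\<dots> \<le> (c + 2 ^ N) * real n powr p"
        using 3 p c by (intro mult_left_mono ge_one_powr_ge_zero) auto
      finally show ?thesis by (simp add: n_def)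
    qed
  qed
  moreover have "1 \<le> c + 2 ^ N" using c one_le_power[of "2::real" N] by linarith
  ultimately show thesis using that by blast
qed

text \<open>The first surplus bound uses a degenerate order of all of \<open>G\<close>, the second
  the subgraph on \<open>S\<close> of minimum degree at least \<open>D\<close>. The edge count on
  \<open>S\<close> is kept in order to bound \<open>D\<close> through ex(n, H).\<close>

lemma surplus_bounds:
  assumes G: "finite_simple_graph G" and E: "edges G \<noteq> {}"
    and sp: "locally_sparse G C \<epsilon>" and C: "1 \<le> C" and \<epsilon>: "0 \<le> \<epsilon>" "\<epsilon> \<le> 1"
    and \<tau>: "\<tau> \<le> \<epsilon>" "\<tau> \<le> 1 / 2"
  obtains D S where "1 \<le> D" "S \<subseteq> verts G" "S \<noteq> {}" "card S * D \<le> 2 * card (edges (induce G S))"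
    "real (card (edges G)) * real D powr (\<tau> - 1) / (2 ^ 14 * C) \<le> surplus G"
    "real D powr (1 + 2 * \<tau>) / (2 ^ 37 * C\<^sup>2) \<le> surplus G"
proof -
  obtain D r S where D: "1 \<le> D" and r: "inj_on r (verts G)"
    and bn: "\<And>v. v \<in> verts G \<Longrightarrow> card (back_nbrs G r v) \<le> D"
    and S: "S \<subseteq> verts G" "S \<noteq> {}" "\<And>v. v \<in> S \<Longrightarrow> D \<le> card (nbrs G v \<inter> S)"
    using degeneracy[OF G E] by metis
  let ?F = "induce G S"
  have F: "finite_simple_graph ?F" by (rule finite_simple_graph_induce[OF G S(1)])
  have degF: "D \<le> card (nbrs ?F v)" if "v \<in> verts ?F" for v
    using S(3)[of v] that by (simp add: nbrs_induce)
  have "(\<Sum>v\<in>verts ?F. D) \<le> 2 * card (edges ?F)"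
    unfolding sum_card_nbrs[OF F, symmetric] by (intro sum_mono degF)
  then have "card S * D \<le> 2 * card (edges ?F)" by simp
  moreover have "real (card (edges G)) * real D powr (\<tau> - 1) / (2 ^ 14 * C) \<le> surplus G"
    by (rule surplus_ge_degenerate[OF G r bn D sp C \<epsilon>(2) \<tau>])
  moreover have "real D powr (1 + 2 * \<tau>) / (2 ^ 37 * C\<^sup>2) \<le> surplus ?F"
  proof (rule surplus_ge_min_degree[OF F _ _ D _ degF locally_sparse_induce[OF sp S(1)] C \<epsilon> \<tau>])
    show "inj_on r (verts ?F)" using inj_on_subset[OF r S(1)] by simp
    show "card (back_nbrs ?F r v) \<le> D" if "v \<in> verts ?F" for v
      using that S(1) card_back_nbrs_induce_le[OF G, of v S r] bn[of v] by fastforce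
    show "verts ?F \<noteq> {}" using S(2) by simp
  qed
  then have "real D powr (1 + 2 * \<tau>) / (2 ^ 37 * C\<^sup>2) \<le> surplus G"
    using surplus_induce_le[OF G S(1)] by linarith
  ultimately show thesis using that D S by blast
qed

section \<open>Balancing the two bounds\<close>

lemma max_two_powr_ge:
  fixes d m \<tau> :: real
  assumes d: "1 \<le> d" and m: "1 \<le> m" and \<tau>: "0 \<le> \<tau>" "\<tau> \<le> 1"
  shows "m powr ((1 + 2 * \<tau>) / (2 + \<tau>)) \<le> max (m * d powr (\<tau> - 1)) (d powr (1 + 2 * \<tau>))"
\<comment> \<open>At this value of \<open>d\<close> both terms equal the left side; above it the
  second term is larger still, below it the first.\<close>
proof (cases "m powr (1 / (2 + \<tau>)) \<le> d")
  case True
  have "m powr ((1 + 2 * \<tau>) / (2 + \<tau>)) = (m powr (1 / (2 + \<tau>))) powr (1 + 2 * \<tau>)"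
    by (simp add: powr_powr)
  also have "\<dots> \<le> d powr (1 + 2 * \<tau>)"
    using True \<tau> by (intro powr_mono2) auto
  finally show ?thesis by simp
next
  case False
  have "(1 + 2 * \<tau>) / (2 + \<tau>) = 1 + 1 / (2 + \<tau>) * (\<tau> - 1)"
    using \<tau> by (simp add: field_simps)
  then have "m powr ((1 + 2 * \<tau>) / (2 + \<tau>)) = m * (m powr (1 / (2 + \<tau>))) powr (\<tau> - 1)"
    using m by (simp add: powr_add powr_powr)
  also have "\<dots> \<le> m * d powr (\<tau> - 1)"
    using False d m \<tau> by (intro mult_left_mono powr_mono2') auto
  finally show ?thesis by simp
qed

lemma min_surplus_ge:
  assumes "\<And>G :: nat graph. finite_simple_graph G \<Longrightarrow> card (edges G) = m \<Longrightarrow> free_of H G \<Longrightarrow> x \<le> surplus G"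
  shows "ereal x \<le> min_surplus m H"
  unfolding min_surplus_def using assms by (intro Inf_greatest) auto

theorem theorem2p1:
  fixes \<epsilon> \<tau> :: real and H :: "'a graph"
  assumes "0 \<le> \<epsilon>" and "\<epsilon> \<le> 1"
    and "\<tau> = min \<epsilon> (1 / 2)"
    and "finite_simple_graph H"
    and "\<exists>v\<in>verts H. bipartite (delete_vertex H v) \<and>
           (\<lambda>n. real (ex_num n (delete_vertex H v))) \<in> O(\<lambda>n. real n powr (2 - \<epsilon>))"
  shows "(\<exists>C::real. C > 0 \<and> (\<forall>m::nat. m \<ge> 1 \<longrightarrow>
            min_surplus m H \<ge> ereal (C * real m powr ((1 + 2 * \<tau>) / (2 + \<tau>)))))
       \<and> (\<forall>\<alpha>::real. 0 \<le> \<alpha> \<and> \<alpha> \<le> 1 \<and>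
            (\<lambda>n. real (ex_num n H)) \<in> O(\<lambda>n. real n powr (2 - \<alpha>)) \<longrightarrow>
            (\<exists>C'::real. C' > 0 \<and> (\<forall>m::nat. m \<ge> 1 \<longrightarrow>
              min_surplus m H \<ge> ereal (C' * real m powr (\<tau> + (1 - \<tau>) / (2 - \<alpha>))))))"
proof -
  have \<tau>: "0 \<le> \<tau>" "\<tau> \<le> \<epsilon>" "\<tau> \<le> 1 / 2" using assms(1,3) by auto
  obtain v where v: "v \<in> verts H"
    and ex: "(\<lambda>n. real (ex_num n (delete_vertex H v))) \<in> O(\<lambda>n. real n powr (2 - \<epsilon>))"
    using assms(5) by blast
  have "0 \<le> 2 - \<epsilon>" using assms(2) by simp
  with ex obtain C where C: "1 \<le> C"
    and C_edges: "\<And>G :: nat graph. finite_simple_graph G \<Longrightarrow> free_of (delete_vertex H v) G \<Longrightarrow>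
      real (card (edges G)) \<le> C * real (card (verts G)) powr (2 - \<epsilon>)"
    by (rule ex_num_bigo_imp_card_edges_le) blast
  have sparse: "locally_sparse G C \<epsilon>" if G: "finite_simple_graph G" "free_of H G" for G :: "nat graph"
    unfolding locally_sparse_def local_edges_def
  proof (intro ballI allI impI)
    fix w S assume w: "w \<in> verts G" and S: "S \<subseteq> nbrs G w"
    have "S \<subseteq> verts G" using S nbrs_subset[OF G(1)] by blast
    from C_edges[OF finite_simple_graph_induce[OF G(1) this]
        free_of_delete_vertex_nbrs[OF G(1) assms(4) v G(2) w S]]
    show "real (card (edges (induce G S))) \<le> C * real (card S) powr (2 - \<epsilon>)" by simp
  qed
  \<comment> \<open>Both surplus bounds are weakened to the common, larger denominator.\<close>
  have C2: "2 ^ 14 * C \<le> 2 ^ 37 * C\<^sup>2"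
    using C by (intro mult_mono) (auto simp: power2_eq_square)
  show ?thesis
  proof (intro conjI allI impI)
    let ?c = "1 / (2 ^ 37 * C\<^sup>2)"
    have "ereal (?c * real m powr ((1 + 2 * \<tau>) / (2 + \<tau>))) \<le> min_surplus m H" if "1 \<le> m" for m
    proof (rule min_surplus_ge)
      fix G :: "nat graph" assume G: "finite_simple_graph G" "card (edges G) = m" "free_of H G"
      then have "edges G \<noteq> {}" using that by auto
      then obtain D where D: "1 \<le> D" "real m * real D powr (\<tau> - 1) / (2 ^ 14 * C) \<le> surplus G"
        "real D powr (1 + 2 * \<tau>) / (2 ^ 37 * C\<^sup>2) \<le> surplus G"
        using surplus_bounds[OF G(1) _ sparse[OF G(1,3)] C assms(1,2) \<tau>(2,3)] G(2) by metis
      have "real m * real D powr (\<tau> - 1) / (2 ^ 37 * C\<^sup>2) \<le> real m * real D powr (\<tau> - 1) / (2 ^ 14 * C)"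
        using C2 C by (intro divide_left_mono) auto
      with D have "max (real m * real D powr (\<tau> - 1)) (real D powr (1 + 2 * \<tau>)) / (2 ^ 37 * C\<^sup>2) \<le> surplus G"
        by (simp add: max_def)
      moreover have "real m powr ((1 + 2 * \<tau>) / (2 + \<tau>)) / (2 ^ 37 * C\<^sup>2) \<le>
          max (real m * real D powr (\<tau> - 1)) (real D powr (1 + 2 * \<tau>)) / (2 ^ 37 * C\<^sup>2)"
        using D(1) that \<tau> by (intro divide_right_mono max_two_powr_ge) auto
      ultimately show "?c * real m powr ((1 + 2 * \<tau>) / (2 + \<tau>)) \<le> surplus G" by simp
    qed
    moreover have "0 < ?c" using C by simp
    ultimately show "\<exists>C::real. C > 0 \<and> (\<forall>m::nat. m \<ge> 1 \<longrightarrow>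
        min_surplus m H \<ge> ereal (C * real m powr ((1 + 2 * \<tau>) / (2 + \<tau>))))" by blast
  next
    fix \<alpha> :: real
    assume \<alpha>: "0 \<le> \<alpha> \<and> \<alpha> \<le> 1 \<and> (\<lambda>n. real (ex_num n H)) \<in> O(\<lambda>n. real n powr (2 - \<alpha>))"
    then have "(\<lambda>n. real (ex_num n H)) \<in> O(\<lambda>n. real n powr (2 - \<alpha>))" "0 \<le> 2 - \<alpha>" by auto
    then obtain K where K: "1 \<le> K" and K_edges: "\<And>G :: nat graph. finite_simple_graph G \<Longrightarrow> free_of H G \<Longrightarrow>
        real (card (edges G)) \<le> K * real (card (verts G)) powr (2 - \<alpha>)"
      by (rule ex_num_bigo_imp_card_edges_le) blast
    \<comment> \<open>The factor (4 K)^(\<tau> - 1) comes from inserting d \<le> 4 K m^((1 -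
      \<alpha>) / (2 - \<alpha>)) into m d^(\<tau> - 1), which decreases in
      \<open>d\<close>.\<close>
    let ?c = "(4 * K) powr (\<tau> - 1) / (2 ^ 14 * C)"
    have "ereal (?c * real m powr (\<tau> + (1 - \<tau>) / (2 - \<alpha>))) \<le> min_surplus m H" if m: "1 \<le> m" for m
    proof (rule min_surplus_ge)
      fix G :: "nat graph" assume G: "finite_simple_graph G" "card (edges G) = m" "free_of H G"
      then have "edges G \<noteq> {}" using m by auto
      then obtain D S where D: "1 \<le> D" "real m * real D powr (\<tau> - 1) / (2 ^ 14 * C) \<le> surplus G"
        and S: "S \<subseteq> verts G" "S \<noteq> {}" "card S * D \<le> 2 * card (edges (induce G S))"
        using surplus_bounds[OF G(1) _ sparse[OF G(1,3)] C assms(1,2) \<tau>(2,3)] G(2) by metis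
      define d where "d = real D"
      define n where "n = real (card S)"
      have d: "1 \<le> d" using D by (simp add: d_def)
      have "finite S" using S(1) finite_verts[OF G(1)] finite_subset by blast
      then have n: "1 \<le> n" using S(2) by (simp add: n_def Suc_le_eq card_gt_0_iff)
      have "real (card S * D) \<le> real (2 * card (edges (induce G S)))" using S(3) by (rule of_nat_mono)
      then have nd: "n * d \<le> 2 * real (card (edges (induce G S)))" by (simp add: n_def d_def)
      have "card (edges (induce G S)) \<le> m"
        unfolding G(2)[symmetric] by (intro card_mono finite_edges G) (auto simp: induce_def)
      then have ndm: "n * d \<le> 2 * real m" using nd by linarith
      \<comment> \<open>The subgraph on \<open>S\<close> is itself H-free, so its average degree,
        and with it \<open>d\<close>, is at most of order n^(1 - \<alpha>).\<close>
      have "n * d \<le> 2 * (K * n powr (2 - \<alpha>))"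
        using nd K_edges[OF finite_simple_graph_induce[OF G(1) S(1)] free_of_induce[OF G(3) S(1)]]
        by (simp add: n_def)
      also have "n powr (2 - \<alpha>) = n * n powr (1 - \<alpha>)"
        using n powr_add[of n 1 "1 - \<alpha>"] by simp
      finally have "n * d \<le> n * (2 * K * n powr (1 - \<alpha>))" by (simp add: ac_simps)
      then have dn: "d \<le> 2 * K * n powr (1 - \<alpha>)"
        using n by (simp add: mult_le_cancel_left_pos)
      \<comment> \<open>Multiplying by d^(1 - \<alpha>) produces n d, which n d \<le> 2 m replaces;
        this eliminates \<open>n\<close>.\<close>
      have "d powr (2 - \<alpha>) = d * d powr (1 - \<alpha>)"
        using d powr_add[of d 1 "1 - \<alpha>"] by simp
      also have "\<dots> \<le> 2 * K * n powr (1 - \<alpha>) * d powr (1 - \<alpha>)"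
        using dn by (intro mult_right_mono) auto
      also have "\<dots> = 2 * K * (n * d) powr (1 - \<alpha>)"
        using n d by (simp add: powr_mult)
      also have "\<dots> \<le> 2 * K * (2 * real m) powr (1 - \<alpha>)"
        using ndm n d K \<alpha> by (intro mult_left_mono powr_mono2) auto
      also have "\<dots> = 2 * K * 2 powr (1 - \<alpha>) * real m powr (1 - \<alpha>)"
        by (simp add: powr_mult)
      also have "\<dots> \<le> 2 * K * 2 powr 1 * real m powr (1 - \<alpha>)"
        using K \<alpha> by (intro mult_right_mono mult_left_mono powr_mono) auto
      finally have "d powr (2 - \<alpha>) \<le> 4 * K * real m powr (1 - \<alpha>)" by simp
      then have "(d powr (2 - \<alpha>)) powr (1 / (2 - \<alpha>)) \<le> (4 * K * real m powr (1 - \<alpha>)) powr (1 / (2 - \<alpha>))"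
        using \<alpha> by (intro powr_mono2) auto
      then have "d \<le> (4 * K) powr (1 / (2 - \<alpha>)) * real m powr ((1 - \<alpha>) / (2 - \<alpha>))"
        using \<alpha> d K by (simp add: powr_powr powr_mult)
      also have "\<dots> \<le> (4 * K) powr 1 * real m powr ((1 - \<alpha>) / (2 - \<alpha>))"
        using \<alpha> K by (intro mult_right_mono powr_mono) auto
      finally have dm: "d \<le> 4 * K * real m powr ((1 - \<alpha>) / (2 - \<alpha>))" using K by simp
      have "\<tau> + (1 - \<tau>) / (2 - \<alpha>) = 1 + (1 - \<alpha>) / (2 - \<alpha>) * (\<tau> - 1)"
        using \<alpha> by (simp add: field_simps)
      then have "?c * real m powr (\<tau> + (1 - \<tau>) / (2 - \<alpha>)) =
          real m * (4 * K * real m powr ((1 - \<alpha>) / (2 - \<alpha>))) powr (\<tau> - 1) / (2 ^ 14 * C)"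
        using m K by (simp add: powr_add powr_powr powr_mult)
      also have "\<dots> \<le> real m * d powr (\<tau> - 1) / (2 ^ 14 * C)"
        using dm d \<tau> C by (intro divide_right_mono mult_left_mono powr_mono2') auto
      also have "\<dots> \<le> surplus G" using D(2) by (simp add: d_def)
      finally show "?c * real m powr (\<tau> + (1 - \<tau>) / (2 - \<alpha>)) \<le> surplus G" .
    qed
    moreover have "0 < ?c" using C K by simp
    ultimately show "\<exists>C'::real. C' > 0 \<and> (\<forall>m::nat. m \<ge> 1 \<longrightarrow>
        min_surplus m H \<ge> ereal (C' * real m powr (\<tau> + (1 - \<tau>) / (2 - \<alpha>))))" by blast
  qed
qed

end
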